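(* Let $p,q>1$ with $\frac1p+\frac1q=1$, $n\ge2$ even, $\alpha\in\mathbb{N}$, $\beta>\frac1\alpha\left(\frac1p+n+2\right)$, let $f\in C^n(\mathbb{R})$ with $f^{(n)}\in L_p(\mathbb{R})$, and let $\xi>0$. Then $$\|K(x)\|_p\le\frac{\tilde\tau^{1/p}\alpha^{1/p}\Gamma\left(\frac{q\beta}{2}-\frac{1}{2\alpha}\right)^{1/q}}{2^{\frac1q}\Gamma(\frac{1}{2\alpha})^{1/p}\Gamma(\beta-\frac{1}{2\alpha})\Gamma(\frac{q\beta}{2})^{1/q}(q(n-1)+1)^{1/q}(2p+1)^{1/p}}\,\frac{\Gamma(\beta)}{(n-1)!}\,\xi^n\,\omega_2(f^{(n)},\xi)_p,$$ where $0<\tilde\tau:=\int_0^\infty\left((1+u)^{2p+1}-1\right)u^{pn-1}\frac{1}{(1+u^{2\alpha})^{p\beta/2}}du<\infty$. Hence $\|K(x)\|_p\to0$ as $\xi\to0$. If additionally $f^{(2m)}\in L_p(\mathbb{R})$ for $m=1,\dots,\frac n2$, then $\|M_\xi(f)-f\|_p\to0$ as $\xi\to0$.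
   Context: For $\alpha\in\mathbb{N}$, $\beta>\frac{1}{2\alpha}$, $\xi>0$, let $W=\frac{\Gamma(\beta)\alpha\xi^{2\alpha\beta-1}}{\Gamma(\frac{1}{2\alpha})\Gamma(\beta-\frac{1}{2\alpha})}$ and define $M_\xi(f;x)=W\int_{-\infty}^{\infty}f(x+y)\frac{1}{(y^{2\alpha}+\xi^{2\alpha})^{\beta}}dy$, $x\in\mathbb{R}$. Let $$K(x):=M_\xi(f;x)-f(x)-\sum_{\rho=1}^{n/2}\frac{f^{(2\rho)}(x)}{(2\rho)!}\frac{\Gamma(\frac{2\rho+1}{2\alpha})\Gamma(\beta-\frac{2\rho+1}{2\alpha})}{\Gamma(\frac{1}{2\alpha})\Gamma(\beta-\frac{1}{2\alpha})}\xi^{2\rho}.$$ For $g\in L_p(\mathbb{R})$, $\Delta_t^2g(x)=g(x+2t)-2g(x+t)+g(x)$ and $\omega_2(g,h)_p=\sup_{|t|\le h}\|\Delta_t^2g(x)\|_{p,x}$, $h>0$. $\|\cdot\|_p$ is the $L_p(\mathbb{R})$ norm in $x$. *)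

theory Defs
  imports "HOL-Analysis.Analysis"
begin

definition Wconst :: "nat \<Rightarrow> real \<Rightarrow> real \<Rightarrow> real" where
  "Wconst \<alpha> \<beta> \<xi> =
     Gamma \<beta> * real \<alpha> * \<xi> powr (2 * real \<alpha> * \<beta> - 1)
     / (Gamma (1 / (2 * real \<alpha>)) * Gamma (\<beta> - 1 / (2 * real \<alpha>)))"

definition Mop :: "nat \<Rightarrow> real \<Rightarrow> real \<Rightarrow> (real \<Rightarrow> real) \<Rightarrow> real \<Rightarrow> real" where
  "Mop \<alpha> \<beta> \<xi> f x =
     Wconst \<alpha> \<beta> \<xi> * (\<integral>y. f (x + y) / (y ^ (2 * \<alpha>) + \<xi> ^ (2 * \<alpha>)) powr \<beta> \<partial>lborel)"

definition Kfun :: "nat \<Rightarrow> real \<Rightarrow> nat \<Rightarrow> real \<Rightarrow> (real \<Rightarrow> real) \<Rightarrow> real \<Rightarrow> real" where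
  "Kfun \<alpha> \<beta> n \<xi> f x =
     Mop \<alpha> \<beta> \<xi> f x - f x
     - (\<Sum>\<rho>\<in>{1..n div 2}. (deriv ^^ (2 * \<rho>)) f x / fact (2 * \<rho>)
          * (Gamma ((2 * real \<rho> + 1) / (2 * real \<alpha>))
             * Gamma (\<beta> - (2 * real \<rho> + 1) / (2 * real \<alpha>))
             / (Gamma (1 / (2 * real \<alpha>)) * Gamma (\<beta> - 1 / (2 * real \<alpha>))))
          * \<xi> ^ (2 * \<rho>))"

definition memLp :: "real \<Rightarrow> (real \<Rightarrow> real) \<Rightarrow> bool" where
  "memLp p g \<longleftrightarrow> g \<in> borel_measurable lborel \<and> integrable lborel (\<lambda>x. \<bar>g x\<bar> powr p)"

definition Lp_norm :: "real \<Rightarrow> (real \<Rightarrow> real) \<Rightarrow> real" where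
  "Lp_norm p g = (\<integral>x. \<bar>g x\<bar> powr p \<partial>lborel) powr (1 / p)"

definition Delta2 :: "real \<Rightarrow> (real \<Rightarrow> real) \<Rightarrow> real \<Rightarrow> real" where
  "Delta2 t g x = g (x + 2 * t) - 2 * g (x + t) + g x"

definition omega2 :: "real \<Rightarrow> (real \<Rightarrow> real) \<Rightarrow> real \<Rightarrow> real" where
  "omega2 p g h = Sup {Lp_norm p (Delta2 t g) | t. \<bar>t\<bar> \<le> h}"

definition Cn :: "nat \<Rightarrow> (real \<Rightarrow> real) \<Rightarrow> bool" where
  "Cn n f \<longleftrightarrow> (\<forall>k<n. ((deriv ^^ k) f) differentiable_on UNIV)
              \<and> (\<forall>k\<le>n. continuous_on UNIV ((deriv ^^ k) f))"

definition tau_integrand :: "real \<Rightarrow> nat \<Rightarrow> nat \<Rightarrow> real \<Rightarrow> real \<Rightarrow> real" where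
  "tau_integrand p n \<alpha> \<beta> u =
     ((1 + u) powr (2 * p + 1) - 1) * u powr (p * real n - 1)
     / (1 + u ^ (2 * \<alpha>)) powr (p * \<beta> / 2)"

definition tau_tilde :: "real \<Rightarrow> nat \<Rightarrow> nat \<Rightarrow> real \<Rightarrow> real" where
  "tau_tilde p n \<alpha> \<beta> = (\<integral>u. indicator {0<..} u * tau_integrand p n \<alpha> \<beta> u \<partial>lborel)"

definition bound_const :: "real \<Rightarrow> real \<Rightarrow> nat \<Rightarrow> nat \<Rightarrow> real \<Rightarrow> real" where
  "bound_const p q n \<alpha> \<beta> =
     tau_tilde p n \<alpha> \<beta> powr (1 / p) * real \<alpha> powr (1 / p)
       * Gamma (q * \<beta> / 2 - 1 / (2 * real \<alpha>)) powr (1 / q)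
     / (2 powr (1 / q) * Gamma (1 / (2 * real \<alpha>)) powr (1 / p)
        * Gamma (\<beta> - 1 / (2 * real \<alpha>)) * Gamma (q * \<beta> / 2) powr (1 / q)
        * (q * (real n - 1) + 1) powr (1 / q) * (2 * p + 1) powr (1 / p))
     * (Gamma \<beta> / fact (n - 1))"

end

theory Submission
  imports Defs
begin

text \<open>
  Folding the integral defining \<open>M\<^sub>\<xi>\<close> onto \<open>(0, \<infinity>)\<close> leaves only even Taylor terms. Their moments
  against the weight are Beta integrals, so they are exactly the terms subtracted in \<open>K\<close>, and
  \<open>K x = W \<integral>\<^sub>0\<^sup>\<infinity> R x y w y dy\<close>, where \<open>R\<close> is the integral remainder with kernel
  \<open>(y - t)^(n - 1) / (n - 1)!\<close> applied to the centred second difference of \<open>f\<^sup>(\<^sup>n\<^sup>)\<close>. Splitting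
  \<open>w = w\<^sup>1\<^sup>/\<^sup>2 w\<^sup>1\<^sup>/\<^sup>2\<close> and applying Hoelder's inequality in \<open>y\<close>, then Hoelder in \<open>t\<close>, Tonelli, and
  \<open>\<omega>\<^sub>2(g, t) \<le> (1 + t/\<xi>)\<^sup>2 \<omega>\<^sub>2(g, \<xi>)\<close> produces the constant; the scaling \<open>y = \<xi> u\<close> gives \<open>\<tau>\<close>.
  Since \<open>\<omega>\<^sub>2(g, \<xi>) \<le> 4 \<parallel>g\<parallel>\<close>, the factor \<open>\<xi>^n\<close> alone forces convergence.
\<close>

section \<open>Norms in \<open>L\<^sub>p\<close>\<close>

text \<open>The bound for K knows only that the n-th derivative lies in L_p, so even convergence of
  the integral in \<open>Mop\<close> has to be extracted from it: Taylor's formula bounds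
  \<open>f (x + y)\<close> by a multiple of \<open>1 + \<bar>y\<bar> ^ n\<close>, and the weight has
  a finite n-th moment. The weight is halved because one half, raised to the power p, must absorb
  the growth in y, while the other, raised to the power q, is a pure moment; its Gamma quotient
  enters the constant. The threshold on \<beta> is integrability of the \<tau> integrand at
  infinity. There it behaves like u to the power pn + 2p - \<alpha>p\<beta>, and this exponent must
  be below -1. Estimates are made with nonnegative integrals. \<open>Lp_norm\<close> rests on the
  Bochner integral, which is 0 for a function that is not integrable, so a norm bound has content
  only together with membership; a bound in \<open>ennreal\<close> gives both and lets Tonelli act
  freely.\<close>

lemma convex_on_powr_nonneg:
  assumes "p \<ge> 1"
  shows "convex_on {0..} (\<lambda>x::real. x powr p)"
proof (rule convex_onI)
  fix t x y :: real
  assume t: "0 < t" "t < 1" and x: "x \<in> {0..}" and y: "y \<in> {0..}"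
  \<comment> \<open>With one endpoint at 0, convexity reduces to \<open>s powr p \<le> s\<close> for
    s between 0 and 1. The point 0 belongs to the domain because absolute values of functions may
    vanish.\<close>
  have le: "(s * z) powr p \<le> s * z powr p" if "0 < s" "s < 1" "0 \<le> z" for s z :: real
  proof -
    have "s powr p \<le> s powr 1"
      using that assms by (intro powr_mono') auto
    then show ?thesis
      using that by (auto simp: powr_mult intro!: mult_right_mono)
  qed
  consider "x = 0" | "y = 0" | "x > 0" "y > 0"
    using x y by fastforce
  then show "((1 - t) *\<^sub>R x + t *\<^sub>R y) powr p \<le> (1 - t) * x powr p + t * y powr p"
  proof cases
    case 3
    then show ?thesis
      using convex_onD[OF powr_convex[OF assms], of t x y] t by simp
  qed (use le[of t y] le[of "1 - t" x] t x y in auto)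
qed simp

text \<open>With \<open>A\<close>, \<open>B\<close> the norms of the summands, integrating this gives Minkowski's inequality.\<close>
lemma powr_add_le_weighted:
  fixes a b A B p :: real
  assumes p: "p \<ge> 1" and ab: "0 \<le> a" "0 \<le> b" and AB: "0 < A" "0 < B"
  shows "(a + b) powr p
    \<le> (A + B) powr p * (A / (A + B) * (a powr p / A powr p) + B / (A + B) * (b powr p / B powr p))"
proof -
  define t where "t = B / (A + B)"
  have t: "0 \<le> t" "t \<le> 1" "1 - t = A / (A + B)"
    using AB by (auto simp: t_def field_simps)
  have "((1 - t) *\<^sub>R (a / A) + t *\<^sub>R (b / B)) powr p \<le> (1 - t) * (a / A) powr p + t * (b / B) powr p"
    using ab AB t by (intro convex_onD[OF convex_on_powr_nonneg[OF p]]) auto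
  moreover have "(1 - t) *\<^sub>R (a / A) + t *\<^sub>R (b / B) = (a + b) / (A + B)"
    using AB unfolding t(3) by (simp add: t_def add_divide_distrib)
  ultimately have "((a + b) / (A + B)) powr p \<le> (1 - t) * (a / A) powr p + t * (b / B) powr p"
    by simp
  then show ?thesis
    using ab AB unfolding t(3) by (simp add: t_def powr_divide field_simps)
qed

section \<open>Passage between \<open>Lp_norm\<close> and nonnegative integrals, and Minkowski's
  inequality\<close>

lemma memLp_iff_nn_integral:
  "memLp p g \<longleftrightarrow> g \<in> borel_measurable lborel \<and> (\<integral>\<^sup>+x. ennreal (\<bar>g x\<bar> powr p) \<partial>lborel) < \<infinity>"
  unfolding memLp_def integrable_iff_bounded by auto

lemma memLp_nn_integral:
  assumes "memLp p g" "p > 0"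
  shows "(\<integral>\<^sup>+x. ennreal (\<bar>g x\<bar> powr p) \<partial>lborel) = ennreal (Lp_norm p g powr p)"
proof -
  have "(\<integral>\<^sup>+x. ennreal (\<bar>g x\<bar> powr p) \<partial>lborel) = ennreal (\<integral>x. \<bar>g x\<bar> powr p \<partial>lborel)"
    using assms by (intro nn_integral_eq_integral) (auto simp: memLp_def)
  moreover have "0 \<le> (\<integral>x. \<bar>g x\<bar> powr p \<partial>lborel)"
    by (rule integral_nonneg_AE) auto
  ultimately show ?thesis
    using assms(2) by (simp add: Lp_norm_def powr_powr)
qed

lemma Lp_norm_nonneg [simp]: "0 \<le> Lp_norm p g"
  by (simp add: Lp_norm_def)

text \<open>Finiteness of the nonnegative integral is what makes the Bochner integral inside
  \<open>Lp_norm\<close> its true value, so a single bound yields membership and the norm estimate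
  together.\<close>

lemma memLp_boundI:
  assumes "g \<in> borel_measurable lborel" "p > 0" "0 \<le> A"
    and "(\<integral>\<^sup>+x. ennreal (\<bar>g x\<bar> powr p) \<partial>lborel) \<le> ennreal (A powr p)"
  shows "memLp p g" "Lp_norm p g \<le> A"
proof -
  show g: "memLp p g"
    using assms by (auto simp: memLp_iff_nn_integral intro: order_le_less_trans)
  have "Lp_norm p g powr p \<le> A powr p"
    using assms by (simp add: memLp_nn_integral[OF g])
  then show "Lp_norm p g \<le> A"
    using assms Lp_norm_nonneg[of p g] powr_less_mono2[of p A "Lp_norm p g"] by linarith
qed

lemma memLp_add:
  assumes p: "p \<ge> 1" and f: "memLp p f" and g: "memLp p g"
  shows memLp_add_mem: "memLp p (\<lambda>x. f x + g x)"
    and Lp_norm_add_le: "Lp_norm p (\<lambda>x. f x + g x) \<le> Lp_norm p f + Lp_norm p g"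
proof -
  have [measurable]: "f \<in> borel_measurable borel" "g \<in> borel_measurable borel"
    using f g by (auto simp: memLp_def)
  \<comment> \<open>A and B are arbitrary positive numbers above the norms, so no division by a
    vanishing norm occurs. A slack of 1 gives membership; a slack of \<open>e/2\<close> with e
    arbitrary gives the triangle inequality.\<close>
  have *: "(\<integral>\<^sup>+x. ennreal (\<bar>f x + g x\<bar> powr p) \<partial>lborel) \<le> ennreal ((A + B) powr p)"
    if A: "Lp_norm p f \<le> A" "0 < A" and B: "Lp_norm p g \<le> B" "0 < B" for A B
  proof -
    define c where "c = (A + B) powr p * (A / (A + B) / A powr p)"
    define d where "d = (A + B) powr p * (B / (A + B) / B powr p)"
    have cd: "0 \<le> c" "0 \<le> d"
      using A B by (auto simp: c_def d_def)
    have "(\<integral>\<^sup>+x. ennreal (\<bar>f x + g x\<bar> powr p) \<partial>lborel)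
        \<le> (\<integral>\<^sup>+x. ennreal c * ennreal (\<bar>f x\<bar> powr p) + ennreal d * ennreal (\<bar>g x\<bar> powr p) \<partial>lborel)"
    proof (rule nn_integral_mono)
      fix x
      have "\<bar>f x + g x\<bar> powr p \<le> (\<bar>f x\<bar> + \<bar>g x\<bar>) powr p"
        using p by (intro powr_mono2) auto
      also have "\<dots> \<le> c * \<bar>f x\<bar> powr p + d * \<bar>g x\<bar> powr p"
        using powr_add_le_weighted[of p "\<bar>f x\<bar>" "\<bar>g x\<bar>" A B] p A B
        by (simp add: c_def d_def algebra_simps)
      finally show "ennreal (\<bar>f x + g x\<bar> powr p)
          \<le> ennreal c * ennreal (\<bar>f x\<bar> powr p) + ennreal d * ennreal (\<bar>g x\<bar> powr p)"
        using cd by (simp flip: ennreal_mult' ennreal_plus)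
    qed
    also have "\<dots> = ennreal (c * Lp_norm p f powr p + d * Lp_norm p g powr p)"
      using p f g cd by (simp add: nn_integral_add nn_integral_cmult memLp_nn_integral ennreal_mult')
    also have "\<dots> \<le> ennreal (c * A powr p + d * B powr p)"
      using A B cd p by (intro ennreal_leI add_mono mult_left_mono powr_mono2) auto
    also have "c * A powr p + d * B powr p = (A + B) powr p * (A / (A + B) + B / (A + B))"
      using A B by (simp add: c_def d_def distrib_left)
    also have "A / (A + B) + B / (A + B) = 1"
      using A B by (simp flip: add_divide_distrib)
    finally show ?thesis by simp
  qed
  show "memLp p (\<lambda>x. f x + g x)"
    using *[of "Lp_norm p f + 1" "Lp_norm p g + 1"] p
    by (intro memLp_boundI[where A = "Lp_norm p f + 1 + (Lp_norm p g + 1)"])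
      (auto simp: add_nonneg_pos)
  show "Lp_norm p (\<lambda>x. f x + g x) \<le> Lp_norm p f + Lp_norm p g"
  proof (rule field_le_epsilon)
    fix e :: real assume "0 < e"
    then have "Lp_norm p (\<lambda>x. f x + g x) \<le> (Lp_norm p f + e/2) + (Lp_norm p g + e/2)"
      using p by (intro memLp_boundI(2)[OF _ _ _ *]) (auto simp: add_nonneg_pos)
    then show "Lp_norm p (\<lambda>x. f x + g x) \<le> Lp_norm p f + Lp_norm p g + e"
      by simp
  qed
qed

lemma memLp_cmult:
  assumes f: "memLp p f" and p: "p > 0"
  shows memLp_cmult_mem: "memLp p (\<lambda>x. c * f x)"
    and Lp_norm_cmult: "Lp_norm p (\<lambda>x. c * f x) = \<bar>c\<bar> * Lp_norm p f"
  using f p by (auto simp: memLp_def Lp_norm_def abs_mult powr_mult powr_powr)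

lemma memLp_sum:
  assumes p: "p \<ge> 1" and "finite I" and "\<And>i. i \<in> I \<Longrightarrow> memLp p (f i)"
  shows memLp_sum_mem: "memLp p (\<lambda>x. \<Sum>i\<in>I. f i x)"
    and Lp_norm_sum_le: "Lp_norm p (\<lambda>x. \<Sum>i\<in>I. f i x) \<le> (\<Sum>i\<in>I. Lp_norm p (f i))"
proof -
  have "memLp p (\<lambda>x. \<Sum>i\<in>I. f i x) \<and> Lp_norm p (\<lambda>x. \<Sum>i\<in>I. f i x) \<le> (\<Sum>i\<in>I. Lp_norm p (f i))"
    using assms(2,3)
  proof (induction I rule: finite_induct)
    case empty
    then show ?case by (auto simp: memLp_def Lp_norm_def)
  next
    case (insert i I)
    then show ?case
      using memLp_add[OF p, of "f i" "\<lambda>x. \<Sum>i\<in>I. f i x"] by force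
  qed
  then show "memLp p (\<lambda>x. \<Sum>i\<in>I. f i x)"
    and "Lp_norm p (\<lambda>x. \<Sum>i\<in>I. f i x) \<le> (\<Sum>i\<in>I. Lp_norm p (f i))" by auto
qed

lemma memLp_translate:
  assumes "memLp p f"
  shows memLp_translate_mem: "memLp p (\<lambda>x. f (x + t))"
    and Lp_norm_translate: "Lp_norm p (\<lambda>x. f (x + t)) = Lp_norm p f"
proof -
  have [measurable]: "f \<in> borel_measurable borel"
    and "integrable lborel (\<lambda>x. \<bar>f x\<bar> powr p)"
    using assms by (auto simp: memLp_def)
  then have "integrable lborel (\<lambda>x. \<bar>f (x + t)\<bar> powr p)"
    using lborel_integrable_real_affine[of "\<lambda>x. \<bar>f x\<bar> powr p" 1 t] by (simp add: add.commute)
  then show "memLp p (\<lambda>x. f (x + t))"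
    by (simp add: memLp_def)
  show "Lp_norm p (\<lambda>x. f (x + t)) = Lp_norm p f"
    using lborel_integral_real_affine[of 1 "\<lambda>x. \<bar>f x\<bar> powr p" t] by (simp add: Lp_norm_def add.commute)
qed

text \<open>Young's inequality for \<open>F x / a\<close> and \<open>G x / b\<close> with
  \<open>a powr p = A\<close> and \<open>b powr q = B\<close>, integrated. A and B are upper bounds
  for the integrals rather than the integrals themselves, so explicit values can be inserted. For A
  = 0 the normalisation is impossible, but then F vanishes almost everywhere.\<close>

lemma nn_integral_Holder:
  fixes F G :: "'a \<Rightarrow> real"
  assumes pq: "p > 1" "q > 1" "1 / p + 1 / q = 1"
    and [measurable]: "F \<in> borel_measurable M" "G \<in> borel_measurable M"
    and nonneg: "\<And>x. x \<in> space M \<Longrightarrow> 0 \<le> F x" "\<And>x. x \<in> space M \<Longrightarrow> 0 \<le> G x"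
    and A: "(\<integral>\<^sup>+x. ennreal (F x powr p) \<partial>M) \<le> ennreal A" "0 \<le> A"
    and B: "(\<integral>\<^sup>+x. ennreal (G x powr q) \<partial>M) \<le> ennreal B" "0 < B"
  shows "(\<integral>\<^sup>+x. ennreal (F x * G x) \<partial>M) \<le> ennreal (A powr (1 / p) * B powr (1 / q))"
proof (cases "A = 0")
  case True
  then have "(\<integral>\<^sup>+x. ennreal (F x powr p) \<partial>M) = 0"
    using A by simp
  then have "AE x in M. ennreal (F x powr p) = 0"
    by (subst (asm) nn_integral_0_iff_AE) auto
  then have "AE x in M. ennreal (F x * G x) = 0"
    by eventually_elim (simp add: ennreal_eq_0_iff)
  then have "(\<integral>\<^sup>+x. ennreal (F x * G x) \<partial>M) = 0"
    by (subst nn_integral_0_iff_AE) auto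
  then show ?thesis by simp
next
  case False
  then have "A > 0" using A by simp
  define a where "a = A powr (1 / p)"
  define b where "b = B powr (1 / q)"
  have ab: "a > 0" "b > 0" "a powr p = A" "b powr q = B"
    using \<open>A > 0\<close> B pq by (auto simp: a_def b_def powr_powr)
  define c where "c = a * b / (p * A)"
  define d where "d = a * b / (q * B)"
  have cd: "0 \<le> c" "0 \<le> d"
    using \<open>A > 0\<close> B pq ab by (auto simp: c_def d_def)
  have "(\<integral>\<^sup>+x. ennreal (F x * G x) \<partial>M)
      \<le> (\<integral>\<^sup>+x. ennreal c * ennreal (F x powr p) + ennreal d * ennreal (G x powr q) \<partial>M)"
  proof (rule nn_integral_mono)
    fix x assume x: "x \<in> space M"
    have "(F x / a) * (G x / b) \<le> (F x / a) powr p / p + (G x / b) powr q / q"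
      using pq nonneg[OF x] ab by (intro Youngs_inequality) auto
    then have "F x * G x \<le> a * b * ((F x / a) powr p / p + (G x / b) powr q / q)"
      using ab by (simp add: field_simps)
    also have "\<dots> = c * F x powr p + d * G x powr q"
      using ab nonneg[OF x] by (simp add: powr_divide c_def d_def distrib_left mult.commute)
    finally show "ennreal (F x * G x) \<le> ennreal c * ennreal (F x powr p) + ennreal d * ennreal (G x powr q)"
      using cd by (simp flip: ennreal_mult' ennreal_plus)
  qed
  also have "\<dots> = ennreal c * (\<integral>\<^sup>+x. ennreal (F x powr p) \<partial>M) + ennreal d * (\<integral>\<^sup>+x. ennreal (G x powr q) \<partial>M)"
    by (simp add: nn_integral_add nn_integral_cmult)
  also have "\<dots> \<le> ennreal c * ennreal A + ennreal d * ennreal B"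
    by (intro add_mono mult_left_mono A B) auto
  also have "\<dots> = ennreal (c * A + d * B)"
    using cd A B by (simp flip: ennreal_mult')
  also have "c * A + d * B = a * b * (1 / p + 1 / q)"
    using \<open>A > 0\<close> B pq by (simp add: c_def d_def field_simps)
  finally show ?thesis
    using pq by (simp add: a_def b_def)
qed

section \<open>The second modulus of smoothness\<close>

text \<open>The 4 is 1 + 2 + 1, the sum of the absolute coefficients of the second difference, since
  translations preserve the norm. It bounds the set whose \<open>Sup\<close> defines
  \<open>omega2\<close>, without which that \<open>Sup\<close> would carry no information.\<close>

lemma memLp_Delta2:
  assumes p: "p \<ge> 1" and g: "memLp p g"
  shows memLp_Delta2_mem: "memLp p (Delta2 t g)"
    and Lp_norm_Delta2_le_4: "Lp_norm p (Delta2 t g) \<le> 4 * Lp_norm p g"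
proof -
  have eq: "Delta2 t g = (\<lambda>x. g (x + 2 * t) + ((-2) * g (x + t) + g x))"
    by (simp add: Delta2_def fun_eq_iff)
  have t: "memLp p (\<lambda>x. g (x + s))" "Lp_norm p (\<lambda>x. g (x + s)) = Lp_norm p g" for s
    using memLp_translate[OF g] by auto
  have c: "memLp p (\<lambda>x. (-2) * g (x + s))" "Lp_norm p (\<lambda>x. (-2) * g (x + s)) = 2 * Lp_norm p g" for s
    using memLp_cmult[OF t(1), of "-2" s] p t(2)[of s] by auto
  note d = memLp_add[OF p c(1) g, of t]
  note e = memLp_add[OF p t(1) d(1), of "2 * t"]
  show "memLp p (Delta2 t g)"
    unfolding eq by (rule e(1))
  show "Lp_norm p (Delta2 t g) \<le> 4 * Lp_norm p g"
    unfolding eq using e(2) d(2) t(2)[of "2 * t"] c(2)[of t] by linarith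
qed

lemma bdd_above_omega2:
  assumes "p \<ge> 1" "memLp p g"
  shows "bdd_above {Lp_norm p (Delta2 t g) | t. \<bar>t\<bar> \<le> h}"
  using Lp_norm_Delta2_le_4[OF assms] by (intro bdd_aboveI[where M = "4 * Lp_norm p g"]) auto

lemma Lp_norm_Delta2_le_omega2:
  assumes "p \<ge> 1" "memLp p g" "\<bar>t\<bar> \<le> h"
  shows "Lp_norm p (Delta2 t g) \<le> omega2 p g h"
  unfolding omega2_def using assms bdd_above_omega2[of p g h]
  by (intro cSup_upper) auto

lemma omega2_nonneg:
  assumes "p \<ge> 1" "memLp p g" "0 \<le> h"
  shows "0 \<le> omega2 p g h"
  using Lp_norm_Delta2_le_omega2[OF assms(1,2), of 0 h] assms(3) Lp_norm_nonneg[of p "Delta2 0 g"]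
  by linarith

lemma omega2_le:
  assumes "p \<ge> 1" "memLp p g" "0 \<le> h"
  shows "omega2 p g h \<le> 4 * Lp_norm p g"
  unfolding omega2_def using assms Lp_norm_Delta2_le_4[OF assms(1,2)]
  by (intro cSup_least) (auto intro!: exI[of _ 0])

text \<open>For the shift Z by s this is the identity (Z^N - 1)^2 = (1 + Z + ... + Z^(N-1))^2 (Z -
  1)^2. It is proved by telescoping first differences in j and then in i.\<close>

lemma Delta2_of_nat_mult:
  "Delta2 (real N * s) g x = (\<Sum>i<N. \<Sum>j<N. Delta2 s g (x + real (i + j) * s))"
proof -
  define D where "D z = g (z + s) - g z" for z
  have "(\<Sum>j<N. Delta2 s g (x + real (i + j) * s)) = D (x + real i * s + real N * s) - D (x + real i * s)" for i
  proof -
    have "(\<Sum>j<N. Delta2 s g (x + real (i + j) * s))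
        = (\<Sum>j<N. D (x + real i * s + real (Suc j) * s) - D (x + real i * s + real j * s))"
      by (intro sum.cong) (auto simp: Delta2_def D_def algebra_simps)
    then show ?thesis
      using sum_lessThan_telescope[of "\<lambda>j. D (x + real i * s + real j * s)" N] by simp
  qed
  moreover have tele: "(\<Sum>i<N. D (z + real i * s)) = g (z + real N * s) - g z" for z
  proof -
    have "(\<Sum>i<N. D (z + real i * s)) = (\<Sum>i<N. g (z + real (Suc i) * s) - g (z + real i * s))"
      by (intro sum.cong) (auto simp: D_def algebra_simps)
    then show ?thesis
      using sum_lessThan_telescope[of "\<lambda>i. g (z + real i * s)" N] by simp
  qed
  ultimately have "(\<Sum>i<N. \<Sum>j<N. Delta2 s g (x + real (i + j) * s))
      = (\<Sum>i<N. D (x + real N * s + real i * s)) - (\<Sum>i<N. D (x + real i * s))"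
    by (simp add: sum_subtractf add_ac del: of_nat_add)
  then show ?thesis
    using tele[of "x + real N * s"] tele[of x] by (simp add: Delta2_def algebra_simps)
qed

text \<open>The step t is cut into N equal steps of length at most h; the second difference then
  becomes N^2 translated ones, each of norm at most \<open>omega2 p g h\<close>, and N is at most 1
  + t/h.\<close>

lemma Lp_norm_Delta2_le:
  assumes p: "p \<ge> 1" and g: "memLp p g" and h: "h > 0" and t: "t \<ge> 0"
  shows "Lp_norm p (Delta2 t g) \<le> (1 + t / h)\<^sup>2 * omega2 p g h"
proof -
  \<comment> \<open>For t = 0 the ceiling is 0; the added 1 keeps N positive, so that
    \<open>t / real N\<close> times N is t again.\<close>
  define N where "N = nat \<lceil>t / h\<rceil> + (if t = 0 then 1 else 0)"
  define s where "s = t / real N"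
  have pos: "0 < t \<Longrightarrow> 0 < \<lceil>t / h\<rceil>"
    using h by simp
  have N: "N > 0" "t / h \<le> real N" "real N \<le> 1 + t / h"
    using t h pos by (auto simp: N_def) (linarith+)?
  have t_eq: "t = real N * s"
    using N by (simp add: s_def)
  have s: "\<bar>s\<bar> \<le> h"
    using N h t by (simp add: s_def field_simps)
  have m: "memLp p (\<lambda>x. Delta2 s g (x + real (i + j) * s))"
    "Lp_norm p (\<lambda>x. Delta2 s g (x + real (i + j) * s)) \<le> omega2 p g h" for i j :: nat
    using memLp_translate[OF memLp_Delta2_mem[OF p g]] Lp_norm_Delta2_le_omega2[OF p g s] by auto
  have "Lp_norm p (Delta2 t g) = Lp_norm p (\<lambda>x. \<Sum>i<N. \<Sum>j<N. Delta2 s g (x + real (i + j) * s))"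
    unfolding t_eq Delta2_of_nat_mult[abs_def] ..
  also have "\<dots> \<le> (\<Sum>i<N. Lp_norm p (\<lambda>x. \<Sum>j<N. Delta2 s g (x + real (i + j) * s)))"
    by (intro Lp_norm_sum_le p memLp_sum_mem m) auto
  also have "\<dots> \<le> (\<Sum>i<N. \<Sum>j<N. Lp_norm p (\<lambda>x. Delta2 s g (x + real (i + j) * s)))"
    by (intro sum_mono Lp_norm_sum_le p m) auto
  also have "\<dots> \<le> (\<Sum>i<N. \<Sum>j<N. omega2 p g h)"
    by (intro sum_mono m)
  also have "\<dots> = (real N)\<^sup>2 * omega2 p g h"
    by (simp add: power2_eq_square)
  also have "\<dots> \<le> (1 + t / h)\<^sup>2 * omega2 p g h"
    using N h by (intro mult_right_mono power_mono omega2_nonneg[OF p g]) auto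
  finally show ?thesis .
qed

section \<open>Moments of the weight\<close>

text \<open>The exponent s is real because two kinds of value occur: s = k + 1 for the moments in K,
  and s = pn and s = pn + 2p + 1 for dominating the \<tau> integrand. The bound on b is
  integrability at infinity.\<close>

lemma has_bochner_integral_powr_weight_1:
  fixes b s :: real and a :: nat
  assumes a: "a \<ge> 1" and s: "s > 0" and b: "b > s / (2 * real a)"
  shows "has_bochner_integral lborel (\<lambda>u. indicator {0<..} u * (u powr (s - 1) / (1 + u ^ (2 * a)) powr b))
    (Gamma (s / (2 * real a)) * Gamma (b - s / (2 * real a)) / (2 * real a * Gamma b))"
proof -
  define e where "e = 1 / (2 * real a)"
  \<comment> \<open>The substitution \<open>u^(2a) = t / (1 - t)\<close> turns the integral into a Beta integral.\<close>
  define g where "g t = (t / (1 - t)) powr e" for t :: real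
  define g' where "g' t = e * (t / (1 - t)) powr (e - 1) / (1 - t)\<^sup>2" for t :: real
  define F where "F u = u powr (s - 1) / (1 + u ^ (2 * a)) powr b" for u :: real
  have e: "e > 0" "e * (2 * real a) = 1" "s / (2 * real a) = s * e"
    using a by (auto simp: e_def)
  have pos: "0 < s * e" "0 < b - s * e"
    using s b e by auto
  have beta: "((\<lambda>t. e * (t powr (s * e - 1) * (1 - t) powr (b - s * e - 1))) has_integral e * Beta (s * e) (b - s * e)) {0..1}"
    by (intro has_integral_mult_right has_integral_Beta_real pos)
  \<comment> \<open>Since 1 + u^(2a) turns into 1/(1 - t), the weight contributes (1 - t)^b and the
    derivative (1 - t)^(-2). The powers of t/(1 - t) have exponents e(s - 1) and e - 1, which add up
    to se - 1.\<close>
  have eq: "F (g t) * g' t = e * (t powr (s * e - 1) * (1 - t) powr (b - s * e - 1))" if t: "0 < t" "t < 1" for t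
  proof -
    have "g t ^ (2 * a) = t / (1 - t)"
      using t e by (simp add: g_def powr_powr flip: powr_realpow)
    then have 1: "1 + g t ^ (2 * a) = 1 / (1 - t)"
      using t by (simp add: field_simps)
    have 3: "F (g t) = g t powr (s - 1) * (1 - t) powr b"
      using t by (simp add: F_def 1 powr_divide)
    have 2: "g t powr (s - 1) = (t / (1 - t)) powr (e * (s - 1))"
      by (simp add: g_def powr_powr)
    have "F (g t) * g' t = e * (((t / (1 - t)) powr (e * (s - 1)) * (t / (1 - t)) powr (e - 1)) * ((1 - t) powr b / (1 - t) powr 2))"
      using t by (simp add: 2 3 g'_def mult_ac)
    also have "(t / (1 - t)) powr (e * (s - 1)) * (t / (1 - t)) powr (e - 1) = (t / (1 - t)) powr (s * e - 1)"
      by (simp flip: powr_add add: algebra_simps)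
    also have "\<dots> = t powr (s * e - 1) * (1 - t) powr (1 - s * e)"
      using t powr_minus_divide[of "1 - t" "s * e - 1"] by (simp add: powr_divide)
    also have "(1 - t) powr b / (1 - t) powr 2 = (1 - t) powr (b - 2)"
      by (simp add: powr_diff)
    also have "t powr (s * e - 1) * (1 - t) powr (1 - s * e) * (1 - t) powr (b - 2)
        = t powr (s * e - 1) * (1 - t) powr (b - s * e - 1)"
      by (simp flip: powr_add add: algebra_simps)
    finally show ?thesis .
  qed
  have int: "set_integrable lborel {0<..<1} (\<lambda>t. F (g t) * g' t)"
    and val: "(LBINT t:{0<..<1}. F (g t) * g' t) = e * Beta (s * e) (b - s * e)"
  proof -
    have "((\<lambda>t. e * (t powr (s * e - 1) * (1 - t) powr (b - s * e - 1))) has_integral e * Beta (s * e) (b - s * e)) {0<..<1}"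
      using beta by (simp add: has_integral_Icc_iff_Ioo)
    then have *: "((\<lambda>t. F (g t) * g' t) has_integral e * Beta (s * e) (b - s * e)) {0<..<1}"
      by (rule has_integral_eq[rotated]) (auto simp: eq)
    have nn: "\<And>t. t \<in> {0<..<1} \<Longrightarrow> 0 \<le> F (g t) * g' t"
      using e by (subst eq) auto
    have [measurable]: "(\<lambda>t. F (g t) * g' t) \<in> borel_measurable borel"
      unfolding F_def g_def g'_def by measurable
    have 1: "(\<integral>\<^sup>+t. ennreal (indicator {0<..<1} t * (F (g t) * g' t)) \<partial>lborel) = ennreal (e * Beta (s * e) (b - s * e))"
      by (rule nn_integral_has_integral_lebesgue[OF nn *])
    have "has_bochner_integral lborel (\<lambda>t. indicator {0<..<1} t * (F (g t) * g' t)) (e * Beta (s * e) (b - s * e))"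
    proof (rule has_bochner_integral_nn_integral[OF _ _ _ 1])
      show "0 \<le> e * Beta (s * e) (b - s * e)"
        by (rule has_integral_nonneg[OF * nn])
    qed (use nn in \<open>auto simp: indicator_def\<close>)
    then show "set_integrable lborel {0<..<1} (\<lambda>t. F (g t) * g' t)"
      "(LBINT t:{0<..<1}. F (g t) * g' t) = e * Beta (s * e) (b - s * e)"
      unfolding set_integrable_def set_lebesgue_integral_def by (simp_all add: has_bochner_integral_iff)
  qed
  have g0: "(g \<longlongrightarrow> 0) (at_right 0)"
  proof -
    have "((\<lambda>t. (t / (1 - t)) powr e) \<longlongrightarrow> (0 / (1 - 0)) powr e) (at_right 0)"
      using e by (intro tendsto_powr' tendsto_intros)
        (auto simp: eventually_at dist_real_def intro!: exI[of _ 1] divide_nonneg_nonneg)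
    then show ?thesis
      by (simp add: g_def[abs_def])
  qed
  \<comment> \<open>The reciprocal of g tends to 0 through positive values, which avoids a limit
    with a vanishing denominator.\<close>
  have g1: "filterlim g at_top (at_left 1)"
  proof (rule filterlim_mono_eventually[OF _ order_refl order_refl])
    have "((\<lambda>t. ((1 - t) / t) powr e) \<longlongrightarrow> ((1 - 1) / 1) powr e) (at_left (1::real))"
      using e by (intro tendsto_powr' tendsto_intros)
        (auto simp: eventually_at intro!: exI[of _ 1] divide_nonneg_nonneg simp: dist_real_def)
    then show "filterlim (\<lambda>t. inverse (((1 - t) / t) powr e)) at_top (at_left (1::real))"
      by (intro filterlim_inverse_at_top)
        (auto simp: eventually_at dist_real_def intro!: exI[of _ 1])
    show "\<forall>\<^sub>F t in at_left 1. inverse (((1 - t) / t) powr e) = g t"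
      by (auto simp: eventually_at dist_real_def g_def powr_divide intro!: exI[of _ 1])
  qed
  have ivl: "einterval 0 \<infinity> = {0::real<..}" "einterval 0 1 = {0::real<..<1}"
    by (auto simp: einterval_def)
  have sub: "set_integrable lborel {0<..} F"
      "(LBINT u=0..\<infinity>. F u) = (LBINT t=0..1. F (g t) * g' t)"
  proof -
    \<comment> \<open>For a nonnegative integrand the substitution rule transfers integrability as
      well as the value, from the Beta integrand on (0, 1) to F on the half-line.\<close>
    note S = interval_integral_substitution_nonneg[of 0 1 g g' F 0 \<infinity>]
    have d: "DERIV g t :> g' t" if "0 < ereal t" "ereal t < 1" for t
    proof -
      have t: "0 < t" "t < 1"
        using that by auto
      then have "((\<lambda>t. t / (1 - t)) has_field_derivative 1 / (1 - t)\<^sup>2) (at t)"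
        by (auto intro!: derivative_eq_intros simp: power2_eq_square)
      from DERIV_chain2[OF has_real_derivative_powr this, of e] t show ?thesis
        by (simp add: g_def[abs_def] g'_def)
    qed
    have F: "isCont F (g t)" if "0 < ereal t" "ereal t < 1" for t
    proof -
      have "0 < g t" "0 < 1 + g t ^ (2 * a)"
        using that by (auto simp: g_def add_pos_nonneg)
      then show ?thesis
        unfolding F_def by (intro continuous_intros) auto
    qed
    have g': "isCont g' t" if "0 < ereal t" "ereal t < 1" for t
      unfolding g'_def using that by (intro continuous_intros) auto
    have A: "((ereal \<circ> g \<circ> real_of_ereal) \<longlongrightarrow> 0) (at_right 0)"
      using g0 unfolding zero_ereal_def ereal_tendsto_simps .
    have B: "((ereal \<circ> g \<circ> real_of_ereal) \<longlongrightarrow> \<infinity>) (at_left 1)"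
      using g1 unfolding one_ereal_def ereal_tendsto_simps .
    have I: "set_integrable lborel (einterval 0 1) (\<lambda>t. F (g t) * g' t)"
      using int by (simp add: ivl)
    have nn: "0 \<le> F (g t)" "0 \<le> g' t" for t
      using e by (auto simp: F_def g'_def)
    show "set_integrable lborel {0<..} F" 
      using S(1)[OF _ d F g' nn A B I] by (simp add: ivl)
    show "(LBINT u=0..\<infinity>. F u) = (LBINT t=0..1. F (g t) * g' t)"
      using S(2)[OF _ d F g' nn A B I] by simp
  qed
  have "(LBINT u:{0<..}. F u) = e * Beta (s * e) (b - s * e)"
    using sub(2) val by (simp add: interval_lebesgue_integral_def ivl)
  then have "has_bochner_integral lborel (\<lambda>u. indicator {0<..} u * F u) (e * Beta (s * e) (b - s * e))"
    using sub(1) by (simp add: has_bochner_integral_iff set_integrable_def set_lebesgue_integral_def)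
  then show ?thesis
    by (simp add: F_def Beta_def e_def mult.commute)
qed

text \<open>Scaling y = \<xi>u: the power of y contributes the exponent s - 1, the weight -2ab and
  dy the exponent 1, in total s - 2ab.\<close>

lemma has_bochner_integral_powr_weight:
  fixes b s \<xi> :: real and a :: nat
  assumes a: "a \<ge> 1" and s: "s > 0" and b: "b > s / (2 * real a)" and \<xi>: "\<xi> > 0"
  shows "has_bochner_integral lborel
    (\<lambda>y. indicator {0<..} y * (y powr (s - 1) / (y ^ (2 * a) + \<xi> ^ (2 * a)) powr b))
    (\<xi> powr (s - 2 * real a * b) *
      (Gamma (s / (2 * real a)) * Gamma (b - s / (2 * real a)) / (2 * real a * Gamma b)))"
    (is "has_bochner_integral _ ?f (_ * ?c)")
proof -
  have *: "?f (0 + \<xi> * u) = \<xi> powr (s - 2 * real a * b - 1) * (indicator {0<..} u * (u powr (s - 1) / (1 + u ^ (2 * a)) powr b))" for u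
  proof (cases "u > 0")
    case True
    have "(\<xi> * u) ^ (2 * a) + \<xi> ^ (2 * a) = \<xi> powr (2 * real a) * (1 + u ^ (2 * a))"
      using \<xi> powr_realpow[of \<xi> "2 * a"] by (simp add: power_mult_distrib distrib_left)
    then have "((\<xi> * u) ^ (2 * a) + \<xi> ^ (2 * a)) powr b = \<xi> powr (2 * real a * b) * (1 + u ^ (2 * a)) powr b"
      by (simp add: powr_mult powr_powr)
    moreover have "(\<xi> * u) powr (s - 1) = \<xi> powr (s - 1) * u powr (s - 1)"
      using \<xi> True by (simp add: powr_mult)
    ultimately show ?thesis
      using \<xi> True by (simp add: powr_diff)
  qed (use \<xi> in \<open>simp add: zero_less_mult_iff\<close>)
  have "has_bochner_integral lborel (\<lambda>u. ?f (0 + \<xi> * u)) (\<xi> powr (s - 2 * real a * b - 1) * ?c)"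
    unfolding * by (intro has_bochner_integral_mult_right has_bochner_integral_powr_weight_1 a s b)
  also have "\<xi> powr (s - 2 * real a * b - 1) * ?c = (\<xi> powr (s - 2 * real a * b) * ?c) /\<^sub>R \<bar>\<xi>\<bar>"
    using \<xi> powr_diff[of \<xi> "s - 2 * real a * b" 1] by (simp add: inverse_eq_divide)
  finally show ?thesis
    using \<xi> by (subst lborel_has_bochner_integral_real_affine_iff[of \<xi> _ _ 0]) auto
qed

section \<open>Taylor expansion of the symmetric difference\<close>

lemma Cn_has_field_derivative:
  assumes "Cn n f" "k < n"
  shows "((deriv ^^ k) f has_field_derivative (deriv ^^ Suc k) f x) (at x)"
proof -
  have "(deriv ^^ k) f differentiable (at x)"
    using assms by (simp add: Cn_def differentiable_on_def)
  then show ?thesis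
    by (simp add: DERIV_deriv_iff_real_differentiable)
qed

lemma Cn_continuous:
  assumes "Cn n f" "k \<le> n"
  shows "continuous_on A ((deriv ^^ k) f)" "(deriv ^^ k) f \<in> borel_measurable borel"
proof -
  have "continuous_on UNIV ((deriv ^^ k) f)"
    using assms by (simp add: Cn_def)
  then show "continuous_on A ((deriv ^^ k) f)" "(deriv ^^ k) f \<in> borel_measurable borel"
    by (auto intro: continuous_on_subset borel_measurable_continuous_onI)
qed

text \<open>Applied with \<sigma> = 1 and \<sigma> = -1, it treats the increments y and -y by one
  formula over the same interval \<open>{0..y}\<close>, so the two remainders can later be added
  under one integral sign. The powers of \<sigma> come from the chain rule.\<close>

lemma Cn_Taylor_direction:
  assumes f: "Cn n f" and n: "n \<ge> 1" and y: "0 \<le> y"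
  shows "((\<lambda>t. (y - t) ^ (n - 1) / fact (n - 1) * (\<sigma> ^ n * (deriv ^^ n) f (x + \<sigma> * t))) has_integral
    f (x + \<sigma> * y) - (\<Sum>i<n. y ^ i / fact i * (\<sigma> ^ i * (deriv ^^ i) f x))) {0..y}"
proof -
  define Df where "Df i t = \<sigma> ^ i * (deriv ^^ i) f (x + \<sigma> * t)" for i t
  have "((\<lambda>t. ((y - t) ^ (n - 1) / fact (n - 1)) *\<^sub>R Df n t) has_integral
      Df 0 y - (\<Sum>i<n. ((y - 0) ^ i / fact i) *\<^sub>R Df i 0)) {0..y}"
  proof (rule Taylor_has_integral)
    fix m t assume m: "m < n"
    have "((\<lambda>t. (deriv ^^ m) f (x + \<sigma> * t)) has_field_derivative (deriv ^^ Suc m) f (x + \<sigma> * t) * \<sigma>) (at t within {0..y})"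
      by (rule DERIV_chain2[OF Cn_has_field_derivative[OF f m]]) (auto intro!: derivative_eq_intros)
    from DERIV_cmult[OF this, of "\<sigma> ^ m"]
    show "(Df m has_vector_derivative Df (Suc m) t) (at t within {0..y})"
      unfolding has_real_derivative_iff_has_vector_derivative[symmetric] Df_def
      by (simp add: mult_ac)
  qed (use n y in auto)
  then show ?thesis
    by (simp add: Df_def)
qed

lemma sum_even_indices:
  fixes g :: "nat \<Rightarrow> 'a::comm_monoid_add"
  assumes "\<And>i. odd i \<Longrightarrow> g i = 0"
  shows "(\<Sum>i<2 * m. g i) = (\<Sum>i<m. g (2 * i))"
  using assms by (induction m) auto

lemma has_integral_power_diff:
  assumes n: "n \<ge> 1" and y: "0 \<le> (y::real)"
  shows "((\<lambda>t. (y - t) ^ (n - 1) / fact (n - 1)) has_integral y ^ n / fact n) {0..y}"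
proof -
  have "((\<lambda>t. (y - t) ^ (n - 1) / fact (n - 1)) has_integral (- ((y - y) ^ n / fact n) - (- ((y - 0) ^ n / fact n)))) {0..y}"
  proof (rule fundamental_theorem_of_calculus[OF y])
    fix t
    have "((\<lambda>t. - ((y - t) ^ n / fact n)) has_field_derivative (y - t) ^ (n - 1) / fact (n - 1)) (at t within {0..y})"
      using n by (auto intro!: derivative_eq_intros simp: fact_reduce field_simps)
    then show "((\<lambda>t. - ((y - t) ^ n / fact n)) has_vector_derivative (y - t) ^ (n - 1) / fact (n - 1)) (at t within {0..y})"
      by (simp add: has_real_derivative_iff_has_vector_derivative)
  qed
  then show ?thesis
    using n by (simp add: power_0_left)
qed

text \<open>The sum includes the term of order n, although the integral remainder of the expansion
  starts at that order. Subtracting this term is what turns the sum of two n-th derivatives into a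
  second difference. The definition by values of f keeps measurability in y and the link to
  \<open>Kfun\<close> immediate.\<close>

definition sym_rem :: "nat \<Rightarrow> (real \<Rightarrow> real) \<Rightarrow> real \<Rightarrow> real \<Rightarrow> real" where
  "sym_rem n f x y = f (x + y) + f (x - y) - 2 * f x
     - 2 * (\<Sum>\<rho>\<in>{1..n div 2}. (deriv ^^ (2 * \<rho>)) f x / fact (2 * \<rho>) * y ^ (2 * \<rho>))"

text \<open>The odd Taylor terms of the two directions cancel. The extra term of order n is written
  as the integral of the same kernel times the constant \<open>2 * (deriv ^^ n) f x\<close>, which
  supplies the middle term of the second difference. The shift to \<open>x - t\<close> centres that
  difference at x.\<close>

lemma has_integral_sym_rem:
  assumes f: "Cn n f" and n: "n \<ge> 1" "even n" and y: "0 \<le> y"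
  shows "((\<lambda>t. (y - t) ^ (n - 1) / fact (n - 1) * Delta2 t ((deriv ^^ n) f) (x - t)) has_integral
    sym_rem n f x y) {0..y}"
proof -
  obtain m where m: "n = 2 * m"
    using n by blast
  define g where "g i = y ^ i / fact i * (deriv ^^ i) f x" for i
  have plus: "((\<lambda>t. (y - t) ^ (n - 1) / fact (n - 1) * (deriv ^^ n) f (x + t)) has_integral
      f (x + y) - (\<Sum>i<n. g i)) {0..y}"
    using Cn_Taylor_direction[OF f n(1) y, of 1 x] by (simp add: g_def)
  have minus: "((\<lambda>t. (y - t) ^ (n - 1) / fact (n - 1) * (deriv ^^ n) f (x - t)) has_integral
      f (x - y) - (\<Sum>i<n. (-1) ^ i * g i)) {0..y}"
    using Cn_Taylor_direction[OF f n(1) y, of "-1" x] n by (simp add: g_def mult_ac)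
  have mid: "((\<lambda>t. 2 * (deriv ^^ n) f x * ((y - t) ^ (n - 1) / fact (n - 1))) has_integral
      2 * (deriv ^^ n) f x * (y ^ n / fact n)) {0..y}"
    by (intro has_integral_mult_right has_integral_power_diff n y)
  have "((\<lambda>t. (y - t) ^ (n - 1) / fact (n - 1) * Delta2 t ((deriv ^^ n) f) (x - t)) has_integral
      (f (x + y) - (\<Sum>i<n. g i)) + (f (x - y) - (\<Sum>i<n. (-1) ^ i * g i))
       - 2 * (deriv ^^ n) f x * (y ^ n / fact n)) {0..y}"
    using has_integral_diff[OF has_integral_add[OF plus minus] mid]
    by (rule has_integral_eq[rotated]) (simp add: Delta2_def algebra_simps)
  also have "(f (x + y) - (\<Sum>i<n. g i)) + (f (x - y) - (\<Sum>i<n. (-1) ^ i * g i))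
       - 2 * (deriv ^^ n) f x * (y ^ n / fact n) = f (x + y) + f (x - y) - (\<Sum>i<n. (1 + (-1) ^ i) * g i) - 2 * g n"
    by (simp add: distrib_right sum.distrib g_def[of n])
  also have "(\<Sum>i<n. (1 + (-1) ^ i) * g i) = (\<Sum>i<m. 2 * g (2 * i))"
    unfolding m by (subst sum_even_indices) auto
  also have "f (x + y) + f (x - y) - (\<Sum>i<m. 2 * g (2 * i)) - 2 * g n
      = f (x + y) + f (x - y) - 2 * (\<Sum>i<Suc m. g (2 * i))"
    by (simp add: m sum_distrib_left)
  also have "(\<Sum>i<Suc m. g (2 * i)) = g 0 + (\<Sum>i\<in>{1..m}. g (2 * i))"
    by (subst lessThan_Suc_atMost, subst atMost_atLeast0, subst sum.atLeast_Suc_atMost) auto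
  also have "f (x + y) + f (x - y) - 2 * (g 0 + (\<Sum>i\<in>{1..m}. g (2 * i))) = sym_rem n f x y"
    by (simp add: sym_rem_def m g_def mult.commute)
  finally show ?thesis .
qed

text \<open>Taylor's formula reduces the claim to the remainder integral. There the crude bound
  \<open>\<bar>z\<bar> \<le> 1 + \<bar>z\<bar> powr p\<close> takes the place of Hoelder's
  inequality: the remainder is at most y^(n-1) (y + L) with L the p-th power of the norm, which is
  of order y^n. C may depend on x, since the integral in \<open>Mop\<close> is taken for fixed
  x.\<close>

lemma Cn_polynomial_growth:
  assumes f: "Cn n f" and n: "n \<ge> 1" and p: "p \<ge> 1" and phi: "memLp p ((deriv ^^ n) f)"
  obtains C where "C \<ge> 0" "\<And>y. \<bar>f (x + y)\<bar> \<le> C * (1 + \<bar>y\<bar> ^ n)"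
proof -
  define L where "L = Lp_norm p ((deriv ^^ n) f) powr p"
  define C where "C = (\<Sum>i<n. \<bar>(deriv ^^ i) f x\<bar>) + 1 + L"
  have L: "L \<ge> 0"
    by (simp add: L_def)
  have C: "C \<ge> 0"
    using L by (simp add: C_def sum_nonneg)
  have pow: "y ^ i \<le> 1 + y ^ n" if "i \<le> n" "0 \<le> y" for y :: real and i
  proof (cases "y \<le> 1")
    case True
    then show ?thesis
      using that power_le_one[of y i] zero_le_power[of y n] by linarith
  next
    case False
    then show ?thesis
      using that power_increasing[of i n y] by linarith
  qed
  have grow: "\<bar>f (x + \<sigma> * y)\<bar> \<le> C * (1 + y ^ n)" if y: "0 \<le> y" and \<sigma>: "\<bar>\<sigma>\<bar> = 1" for y \<sigma>
  proof -
    have cont: "continuous_on A (\<lambda>t. (deriv ^^ n) f (x + \<sigma> * t))" for A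
      by (rule continuous_on_compose2[OF Cn_continuous(1)[OF f order_refl, of UNIV]]) (auto intro!: continuous_intros)
    let ?h = "\<lambda>t. \<bar>(deriv ^^ n) f (x + \<sigma> * t)\<bar> powr p"
    have int: "?h integrable_on {0..y}"
      using p by (intro integrable_continuous_real continuous_on_powr' continuous_intros cont) auto
    \<comment> \<open>As \<bar>\<sigma>\<bar> = 1 the change of variables has Jacobian 1, so the
      integral over \<open>{0..y}\<close> is at most the one over the whole line, uniformly in
      y.\<close>
    have "integral {0..y} ?h \<le> L"
    proof -
      have "ennreal (integral {0..y} ?h) = (\<integral>\<^sup>+t. ennreal (indicator {0..y} t * ?h t) \<partial>lborel)"
        by (rule nn_integral_has_integral_lebesgue[symmetric]) (use int in \<open>auto intro: integrable_integral\<close>)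
      also have "\<dots> \<le> (\<integral>\<^sup>+t. ennreal (?h t) \<partial>lborel)"
        by (intro nn_integral_mono ennreal_leI) (auto simp: indicator_def)
      also have "\<dots> = (\<integral>\<^sup>+t. ennreal (\<bar>(deriv ^^ n) f t\<bar> powr p) \<partial>lborel)"
        using \<sigma> Cn_continuous(2)[OF f order_refl]
        by (subst nn_integral_real_affine[of "\<lambda>t. ennreal (\<bar>(deriv ^^ n) f t\<bar> powr p)" \<sigma> x]) auto
      also have "\<dots> = ennreal L"
        using memLp_nn_integral[OF phi] p by (simp add: L_def)
      finally show ?thesis
        using L by simp
    qed
    define i where "i t = (y - t) ^ (n - 1) / fact (n - 1) * (\<sigma> ^ n * (deriv ^^ n) f (x + \<sigma> * t))" for t
    define S where "S = (\<Sum>i<n. y ^ i / fact i * (\<sigma> ^ i * (deriv ^^ i) f x))"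
    have I: "(i has_integral f (x + \<sigma> * y) - S) {0..y}"
      unfolding i_def S_def by (rule Cn_Taylor_direction[OF f n y])
    have S: "\<bar>S\<bar> \<le> (\<Sum>i<n. \<bar>(deriv ^^ i) f x\<bar>) * (1 + y ^ n)"
      unfolding S_def sum_distrib_right
    proof (rule order_trans[OF sum_abs], rule sum_mono)
      fix i assume "i \<in> {..<n}"
      have "y ^ i / fact i \<le> y ^ i / 1"
        using y by (intro frac_le) auto
      with \<open>i \<in> {..<n}\<close> have le: "y ^ i / fact i \<le> 1 + y ^ n"
        using y pow[of i y] by simp
      show "\<bar>y ^ i / fact i * (\<sigma> ^ i * (deriv ^^ i) f x)\<bar> \<le> \<bar>(deriv ^^ i) f x\<bar> * (1 + y ^ n)"
        using \<sigma> y mult_right_mono[OF le abs_ge_zero[of "(deriv ^^ i) f x"]] by (simp add: abs_mult power_abs mult_ac)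
    qed
    have "\<bar>f (x + \<sigma> * y) - S\<bar> \<le> integral {0..y} (\<lambda>t. y ^ (n - 1) * (1 + ?h t))"
    proof -
      have "norm (integral {0..y} i) \<le> integral {0..y} (\<lambda>t. y ^ (n - 1) * (1 + ?h t))"
      proof (rule integral_norm_bound_integral)
        show "(\<lambda>t. y ^ (n - 1) * (1 + ?h t)) integrable_on {0..y}"
          using int by (intro integrable_on_mult_right integrable_add) auto
        fix t assume t: "t \<in> {0..y}"
        have 1: "(y - t) ^ (n - 1) / fact (n - 1) \<le> y ^ (n - 1) / 1"
          using t by (intro frac_le power_mono) auto
        have 2: "\<bar>z\<bar> \<le> 1 + \<bar>z\<bar> powr p" for z :: real
        proof (cases "\<bar>z\<bar> \<le> 1")
          case False
          then show ?thesis
            using powr_mono[OF p, of "\<bar>z\<bar>"] by simp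
        qed (simp add: add_increasing2)
        show "norm (i t) \<le> y ^ (n - 1) * (1 + ?h t)"
          using mult_mono[OF 1 2, of "(deriv ^^ n) f (x + \<sigma> * t)"] t \<sigma>
          by (simp add: i_def abs_mult power_abs)
      qed (use I in auto)
      then show ?thesis
        using I by (simp add: integral_unique)
    qed
    also have "\<dots> = y ^ (n - 1) * (y + integral {0..y} ?h)"
      using int y integral_add[OF integrable_const_ivl int, of 1] by simp
    also have "\<dots> \<le> y ^ (n - 1) * (y + L)"
      using \<open>integral {0..y} ?h \<le> L\<close> y by (intro mult_left_mono) auto
    also have "\<dots> = y ^ n + y ^ (n - 1) * L"
      using n by (cases n) (auto simp: algebra_simps)
    also have "\<dots> \<le> (1 + L) * (1 + y ^ n)"
      using mult_right_mono[OF pow[of "n - 1" y] L] y by (simp add: algebra_simps)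
    finally show ?thesis
      using S by (simp add: C_def algebra_simps)
  qed
  have "\<bar>f (x + y)\<bar> \<le> C * (1 + \<bar>y\<bar> ^ n)" for y
    using grow[of y 1] grow[of "- y" "-1"] by (cases "0 \<le> y") auto
  with C that show ?thesis by blast
qed

section \<open>Reduction of \<open>Kfun\<close> to a half-line integral of the symmetric
  remainder\<close>

lemma has_bochner_integral_fold:
  fixes h :: "real \<Rightarrow> real"
  assumes [measurable]: "h \<in> borel_measurable borel"
    and 1: "integrable lborel (\<lambda>y. indicator {0<..} y * h y)"
    and 2: "integrable lborel (\<lambda>y. indicator {0<..} y * h (- y))"
  shows "has_bochner_integral lborel h (\<integral>y. indicator {0<..} y * (h y + h (- y)) \<partial>lborel)"
proof -
  let ?I = "\<lambda>h::real \<Rightarrow> real. \<integral>y. indicator {0<..} y * h y \<partial>lborel"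
  have "has_bochner_integral lborel (\<lambda>y. indicator {0<..} (- y) * h y) (?I (\<lambda>y. h (- y)))"
    using has_bochner_integral_integrable[OF 2]
    by (subst lborel_has_bochner_integral_real_affine_iff[of "-1" _ _ 0]) auto
  from has_bochner_integral_add[OF has_bochner_integral_integrable[OF 1] this]
  have "has_bochner_integral lborel h (?I h + ?I (\<lambda>y. h (- y)))"
  proof (rule has_bochner_integral_cong_AE[THEN iffD1, rotated -1])
    show "AE y in lborel. indicator {0<..} y * h y + indicator {0<..} (- y) * h y = h y"
      using AE_lborel_singleton[of 0] by eventually_elim (auto simp: indicator_def)
  qed auto
  also have "?I h + ?I (\<lambda>y. h (- y)) = ?I (\<lambda>y. h y + h (- y))"
    using 1 2 by (simp add: distrib_left)
  finally show ?thesis .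
qed

lemma has_bochner_integral_moment:
  fixes b \<xi> :: real and a k :: nat
  assumes a: "a \<ge> 1" and b: "b > (real k + 1) / (2 * real a)" and \<xi>: "\<xi> > 0"
  shows "has_bochner_integral lborel
    (\<lambda>y. indicator {0<..} y * (y ^ k / (y ^ (2 * a) + \<xi> ^ (2 * a)) powr b))
    (\<xi> powr (real k + 1 - 2 * real a * b) *
      (Gamma ((real k + 1) / (2 * real a)) * Gamma (b - (real k + 1) / (2 * real a)) / (2 * real a * Gamma b)))"
proof -
  have "(\<lambda>y::real. indicator {0<..} y * (y powr (real k + 1 - 1) / (y ^ (2 * a) + \<xi> ^ (2 * a)) powr b))
      = (\<lambda>y. indicator {0<..} y * (y ^ k / (y ^ (2 * a) + \<xi> ^ (2 * a)) powr b))"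
    by (auto simp: indicator_def powr_realpow)
  then show ?thesis
    using has_bochner_integral_powr_weight[OF a _ b \<xi>] by (simp del: add_diff_cancel_right')
qed

text \<open>The factor 2 accounts for the negative half-line, the weight being even. For k = 0 the
  right side is 1, which says that \<open>Wconst\<close> makes the weight a probability density; for
  k = 2\<rho> it is the coefficient in \<open>Kfun\<close>.\<close>

lemma Wconst_moment:
  fixes b \<xi> :: real and a k :: nat
  assumes a: "a \<ge> 1" and b: "b > 0" and \<xi>: "\<xi> > 0"
  shows "2 * Wconst a b \<xi> * (\<xi> powr (real k + 1 - 2 * real a * b) *
      (Gamma ((real k + 1) / (2 * real a)) * Gamma (b - (real k + 1) / (2 * real a)) / (2 * real a * Gamma b)))
    = Gamma ((real k + 1) / (2 * real a)) * Gamma (b - (real k + 1) / (2 * real a))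
       / (Gamma (1 / (2 * real a)) * Gamma (b - 1 / (2 * real a))) * \<xi> ^ k"
    (is "2 * _ * (_ * (?g / _)) = _ / ?d * _")
proof -
  have "\<xi> powr (2 * real a * b - 1) * \<xi> powr (real k + 1 - 2 * real a * b) = \<xi> ^ k"
    using \<xi> by (simp flip: powr_add powr_realpow)
  moreover have "Gamma b > 0"
    using b by simp
  moreover have "2 * Wconst a b \<xi> * (\<xi> powr (real k + 1 - 2 * real a * b) * (?g / (2 * real a * Gamma b)))
      = (\<xi> powr (2 * real a * b - 1) * \<xi> powr (real k + 1 - 2 * real a * b)) * (?g / ?d)
          * ((2 * real a * Gamma b) / (2 * real a * Gamma b))"
    by (simp add: Wconst_def)
  ultimately show ?thesis
    using a by simp
qed

context
  fixes b \<xi> p :: real and a n :: nat and f :: "real \<Rightarrow> real"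
  assumes a: "a \<ge> 1" and b: "b > (real n + 1) / (2 * real a)" and \<xi>: "\<xi> > 0"
    and f: "Cn n f" and n: "n \<ge> 1" and p: "p \<ge> 1" and phi: "memLp p ((deriv ^^ n) f)"
begin

text \<open>The growth bound dominates the integrand by C times the sum of the integrands of the
  moments 0 and n. The assumption on b is finiteness of the n-th moment, hence also of the
  zeroth.\<close>

lemma integrable_half_translate:
  assumes \<sigma>: "\<bar>\<sigma>\<bar> = (1::real)"
  shows "integrable lborel (\<lambda>y. indicator {0<..} y * (f (x + \<sigma> * y) / (y ^ (2 * a) + \<xi> ^ (2 * a)) powr b))"
proof -
  have [measurable]: "f \<in> borel_measurable borel"
    using Cn_continuous(2)[OF f, of 0] by simp
  obtain C where C: "C \<ge> 0" "\<And>y. \<bar>f (x + y)\<bar> \<le> C * (1 + \<bar>y\<bar> ^ n)"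
    using Cn_polynomial_growth[OF f n p phi] by blast
  have b0: "b > (real 0 + 1) / (2 * real a)"
    using a by (intro le_less_trans[OF _ b] divide_right_mono) auto
  let ?m = "\<lambda>k (y::real). indicator {0<..} y * (y ^ k / (y ^ (2 * a) + \<xi> ^ (2 * a)) powr b)"
  have int: "integrable lborel (?m 0)" "integrable lborel (?m n)"
    using has_bochner_integral_moment[OF a b0 \<xi>] has_bochner_integral_moment[OF a b \<xi>]
    by (auto simp: has_bochner_integral_iff)
  show ?thesis
  proof (rule Bochner_Integration.integrable_bound)
    show "integrable lborel (\<lambda>y. C * (?m 0 y + ?m n y))"
      using int by auto
    have "norm (indicator {0<..} y * (f (x + \<sigma> * y) / (y ^ (2 * a) + \<xi> ^ (2 * a)) powr b))
        \<le> norm (C * (?m 0 y + ?m n y))" for y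
    proof (cases "y > 0")
      case True
      have "\<bar>f (x + \<sigma> * y)\<bar> \<le> C * (1 + y ^ n)"
        using C(2)[of "\<sigma> * y"] \<sigma> True by (simp add: abs_mult)
      then have "\<bar>f (x + \<sigma> * y)\<bar> / (y ^ (2 * a) + \<xi> ^ (2 * a)) powr b
          \<le> C * (1 + y ^ n) / (y ^ (2 * a) + \<xi> ^ (2 * a)) powr b"
        by (rule divide_right_mono) simp
      also have "\<dots> = C * (?m 0 y + ?m n y)"
        using True by (simp add: add_divide_distrib distrib_left)
      finally show ?thesis
        using True C(1) by simp
    qed auto
    then show "AE y in lborel. norm (indicator {0<..} y * (f (x + \<sigma> * y) / (y ^ (2 * a) + \<xi> ^ (2 * a)) powr b))
        \<le> norm (C * (?m 0 y + ?m n y))" by simp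
  qed measurable
qed

lemma has_bochner_integral_translate:
  "has_bochner_integral lborel (\<lambda>y. f (x + y) / (y ^ (2 * a) + \<xi> ^ (2 * a)) powr b)
    (\<integral>y. indicator {0<..} y * ((f (x + y) + f (x - y)) / (y ^ (2 * a) + \<xi> ^ (2 * a)) powr b) \<partial>lborel)"
proof -
  have [measurable]: "f \<in> borel_measurable borel"
    using Cn_continuous(2)[OF f, of 0] by simp
  show ?thesis
    using has_bochner_integral_fold[of "\<lambda>y. f (x + y) / (y ^ (2 * a) + \<xi> ^ (2 * a)) powr b"]
      integrable_half_translate[of 1 x] integrable_half_translate[of "-1" x]
    by (simp add: add_divide_distrib)
qed

text \<open>Linearity of the Bochner integral requires every piece to be integrable, so values and
  integrability travel together as \<open>has_bochner_integral\<close>. The highest moment that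
  occurs is the one of order n.\<close>

lemma Kfun_eq:
  assumes "even n"
  shows "Kfun a b n \<xi> f x = Wconst a b \<xi> *
      (\<integral>y. indicator {0<..} y * (sym_rem n f x y / (y ^ (2 * a) + \<xi> ^ (2 * a)) powr b) \<partial>lborel)"
proof -
  let ?w = "\<lambda>y::real. (y ^ (2 * a) + \<xi> ^ (2 * a)) powr b"
  define M where "M k = \<xi> powr (real k + 1 - 2 * real a * b) *
      (Gamma ((real k + 1) / (2 * real a)) * Gamma (b - (real k + 1) / (2 * real a)) / (2 * real a * Gamma b))" for k
  define c where "c \<rho> = (deriv ^^ (2 * \<rho>)) f x / fact (2 * \<rho>)" for \<rho>
  have le: "(real k + 1) / (2 * real a) < b" if "k \<le> n" for k
    using that by (intro le_less_trans[OF _ b] divide_right_mono) auto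
  have b_pos: "b > 0"
    using le[of 0] a by (intro less_trans[OF _ le[of 0]]) auto
  have moment: "has_bochner_integral lborel (\<lambda>y. indicator {0<..} y * (y ^ k / ?w y)) (M k)" if "k \<le> n" for k
    unfolding M_def by (intro has_bochner_integral_moment a \<xi> le that)
  have WM: "2 * Wconst a b \<xi> * M k = Gamma ((real k + 1) / (2 * real a)) * Gamma (b - (real k + 1) / (2 * real a))
       / (Gamma (1 / (2 * real a)) * Gamma (b - 1 / (2 * real a))) * \<xi> ^ k" for k
    unfolding M_def by (intro Wconst_moment a \<xi> b_pos)
  have "Gamma (1 / (2 * real a)) > 0" "Gamma (b - 1 / (2 * real a)) > 0"
    using a le[of 0] by (auto intro!: Gamma_real_pos)
  then have WM0: "2 * Wconst a b \<xi> * M 0 = 1"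
    by (subst WM) auto
  define I where "I = (\<integral>y. indicator {0<..} y * ((f (x + y) + f (x - y)) / ?w y) \<partial>lborel)"
  have I: "has_bochner_integral lborel (\<lambda>y. indicator {0<..} y * ((f (x + y) + f (x - y)) / ?w y)) I"
    using integrable_half_translate[of 1 x] integrable_half_translate[of "-1" x]
    by (simp add: has_bochner_integral_iff I_def add_divide_distrib distrib_left)
  have Mop: "Mop a b \<xi> f x = Wconst a b \<xi> * I"
    using has_bochner_integral_translate[of x] by (simp add: Mop_def I_def has_bochner_integral_iff)
  have "has_bochner_integral lborel
      (\<lambda>y. indicator {0<..} y * ((f (x + y) + f (x - y)) / ?w y) - 2 * f x * (indicator {0<..} y * (y ^ 0 / ?w y))
         - (\<Sum>\<rho>\<in>{1..n div 2}. 2 * c \<rho> * (indicator {0<..} y * (y ^ (2 * \<rho>) / ?w y))))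
      (I - 2 * f x * M 0 - (\<Sum>\<rho>\<in>{1..n div 2}. 2 * c \<rho> * M (2 * \<rho>)))"
    by (intro has_bochner_integral_diff has_bochner_integral_sum has_bochner_integral_mult_right I moment) auto
  also have "(\<lambda>y. indicator {0<..} y * ((f (x + y) + f (x - y)) / ?w y) - 2 * f x * (indicator {0<..} y * (y ^ 0 / ?w y))
         - (\<Sum>\<rho>\<in>{1..n div 2}. 2 * c \<rho> * (indicator {0<..} y * (y ^ (2 * \<rho>) / ?w y))))
      = (\<lambda>y. indicator {0<..} y * (sym_rem n f x y / ?w y))"
    by (rule ext) (simp add: sym_rem_def c_def diff_divide_distrib sum_divide_distrib sum_distrib_left indicator_def mult.assoc)
  finally have int: "(\<integral>y. indicator {0<..} y * (sym_rem n f x y / ?w y) \<partial>lborel)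
      = I - 2 * f x * M 0 - (\<Sum>\<rho>\<in>{1..n div 2}. 2 * c \<rho> * M (2 * \<rho>))"
    by (simp add: has_bochner_integral_iff)
  \<comment> \<open>Each moment is grouped with \<open>2 * Wconst a b \<xi>\<close>. The zeroth
    group equals 1 and leaves \<open>f x\<close>, the others are the Gamma quotients of
    \<open>Kfun\<close>.\<close>
  have "Wconst a b \<xi> * (I - 2 * f x * M 0 - (\<Sum>\<rho>\<in>{1..n div 2}. 2 * c \<rho> * M (2 * \<rho>)))
      = Wconst a b \<xi> * I - f x * (2 * Wconst a b \<xi> * M 0) - (\<Sum>\<rho>\<in>{1..n div 2}. c \<rho> * (2 * Wconst a b \<xi> * M (2 * \<rho>)))"
    by (simp add: right_diff_distrib sum_distrib_left mult_ac)
  also have "\<dots> = Kfun a b n \<xi> f x"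
    unfolding WM0 unfolding WM Kfun_def Mop by (simp add: c_def mult.assoc)
  finally show ?thesis
    by (simp only: int)
qed

end

section \<open>The pointwise bound\<close>

lemma nn_integral_powr_reflect:
  assumes r: "r \<ge> 0" and y: "y \<ge> (0::real)"
  shows "(\<integral>\<^sup>+t. ennreal (indicator {0..y} t * (y - t) powr r) \<partial>lborel) = ennreal (y powr (r + 1) / (r + 1))"
proof -
  have "(\<integral>\<^sup>+t. ennreal (indicator {0..y} t * t powr r) \<partial>lborel) = ennreal (y powr (r + 1) / (r + 1))"
    using r by (intro nn_integral_has_integral_lebesgue has_integral_powr_from_0 y) auto
  also have "(\<integral>\<^sup>+t. ennreal (indicator {0..y} t * t powr r) \<partial>lborel)
      = (\<integral>\<^sup>+t. ennreal (indicator {0..y} (y - t) * (y - t) powr r) \<partial>lborel)"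
    by (subst nn_integral_real_affine[of _ "-1" y]) auto
  also have "(\<lambda>t. indicator {0..y} (y - t) :: real) = indicator {0..y}"
    by (auto simp: indicator_def)
  finally show ?thesis by simp
qed

text \<open>Hoelder in t, with the kernel (y - t)^(n-1) in L_q. Its q-th power integrates to
  y^(r+1)/(r+1) for r = q(n-1), and raising this to p/q = p - 1 gives y^(pn-1), because q(p-1) = p.
  This is the origin of the factor q(n-1) + 1 and of the power of u in \<tau>.\<close>

lemma sym_rem_powr_le:
  fixes p q x y :: real
  assumes pq: "p > 1" "q > 1" "1 / p + 1 / q = 1"
    and f: "Cn n f" and n: "n \<ge> 2" "even n" and y: "y > 0"
  shows "ennreal (\<bar>sym_rem n f x y\<bar> powr p)
    \<le> ennreal (y powr (p * real n - 1) / (fact (n - 1) powr p * (q * (real n - 1) + 1) powr (p / q)))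
        * (\<integral>\<^sup>+t. ennreal (indicator {0..y} t * \<bar>Delta2 t ((deriv ^^ n) f) (x - t)\<bar> powr p) \<partial>lborel)"
proof -
  define r where "r = q * (real n - 1)"
  have r: "r \<ge> 0" "r + 1 > 0"
    using pq n by (auto simp: r_def add_nonneg_pos)
  let ?d = "\<lambda>t. Delta2 t ((deriv ^^ n) f) (x - t)"
  have cont': "continuous_on A (\<lambda>t. (deriv ^^ n) f (h t))" if "continuous_on A h" for A h
    by (rule continuous_on_compose2[OF Cn_continuous(1)[OF f order_refl, of UNIV] that]) auto
  have cont: "continuous_on A ?d" for A
    unfolding Delta2_def by (intro continuous_intros cont')
  have meas [measurable]: "?d \<in> borel_measurable borel"
    by (intro borel_measurable_continuous_onI cont)
  define A where "A = integral {0..y} (\<lambda>t. \<bar>?d t\<bar> powr p)"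
  have A_int: "((\<lambda>t. \<bar>?d t\<bar> powr p) has_integral A) {0..y}"
    unfolding A_def using pq
    by (intro integrable_integral integrable_continuous_real continuous_on_powr' continuous_intros cont) auto
  have A: "A \<ge> 0" "(\<integral>\<^sup>+t. ennreal (indicator {0..y} t * \<bar>?d t\<bar> powr p) \<partial>lborel) = ennreal A"
    using has_integral_nonneg[OF A_int] nn_integral_has_integral_lebesgue[OF _ A_int] by auto
  define B where "B = y powr (r + 1) / (r + 1)"
  have B: "B > 0"
    using y r by (simp add: B_def)
  define F where "F t = indicator {0..y} t * \<bar>?d t\<bar>" for t
  define G where "G t = indicator {0..y} t * (y - t) ^ (n - 1)" for t
  have "(\<integral>\<^sup>+t. ennreal (F t * G t) \<partial>lborel) \<le> ennreal (A powr (1 / p) * B powr (1 / q))"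
  proof (rule nn_integral_Holder[OF pq])
    have "F t powr p = indicator {0..y} t * \<bar>?d t\<bar> powr p" for t
      by (simp add: F_def indicator_def)
    then show "(\<integral>\<^sup>+t. ennreal (F t powr p) \<partial>lborel) \<le> ennreal A"
      using A by simp
    \<comment> \<open>The endpoint t = y is separate because \<open>powr\<close> agrees with
      iterated powers only for a positive base; there both sides are 0, as n - 1 > 0 and
      \<open>0 powr r = 0\<close>.\<close>
    have "G t powr q = indicator {0..y} t * (y - t) powr r" for t
    proof (cases "t \<in> {0..<y}")
      case True
      then show ?thesis
        using n by (simp add: G_def r_def powr_powr mult.commute flip: powr_realpow)
    next
      case False
      then show ?thesis
        using n by (cases "t = y") (auto simp: G_def indicator_def)
    qed
    then show "(\<integral>\<^sup>+t. ennreal (G t powr q) \<partial>lborel) \<le> ennreal B"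
      using nn_integral_powr_reflect[OF r(1), of y] y by (simp add: B_def)
  qed (use A B in \<open>auto simp: F_def G_def indicator_def\<close>)
  moreover have "ennreal (fact (n - 1) * \<bar>sym_rem n f x y\<bar>) \<le> (\<integral>\<^sup>+t. ennreal (F t * G t) \<partial>lborel)"
  proof -
    let ?J = "integral {0..y} (\<lambda>t. (y - t) ^ (n - 1) * \<bar>?d t\<bar>)"
    have int: "(\<lambda>t. (y - t) ^ (n - 1) * \<bar>?d t\<bar>) integrable_on {0..y}"
      by (intro integrable_continuous_real continuous_intros cont)
    have "((\<lambda>t. fact (n - 1) * ((y - t) ^ (n - 1) / fact (n - 1) * ?d t)) has_integral fact (n - 1) * sym_rem n f x y) {0..y}"
      using n y by (intro has_integral_mult_right has_integral_sym_rem f) auto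
    then have R: "((\<lambda>t. (y - t) ^ (n - 1) * ?d t) has_integral fact (n - 1) * sym_rem n f x y) {0..y}"
      by simp
    have "norm (integral {0..y} (\<lambda>t. (y - t) ^ (n - 1) * ?d t)) \<le> ?J"
      by (rule integral_norm_bound_integral[OF has_integral_integrable[OF R] int]) (simp add: abs_mult)
    then have "fact (n - 1) * \<bar>sym_rem n f x y\<bar> \<le> ?J"
      using R by (simp add: integral_unique abs_mult)
    moreover have "(\<integral>\<^sup>+t. ennreal (indicator {0..y} t * ((y - t) ^ (n - 1) * \<bar>?d t\<bar>)) \<partial>lborel) = ennreal ?J"
      by (rule nn_integral_has_integral_lebesgue) (use int in \<open>auto intro: integrable_integral\<close>)
    moreover have "indicator {0..y} t * ((y - t) ^ (n - 1) * \<bar>?d t\<bar>) = F t * G t" for t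
      by (simp add: F_def G_def indicator_def)
    ultimately show ?thesis
      by (simp add: ennreal_leI)
  qed
  ultimately have "fact (n - 1) * \<bar>sym_rem n f x y\<bar> \<le> A powr (1 / p) * B powr (1 / q)"
    by (meson order_trans ennreal_le_iff powr_ge_zero mult_nonneg_nonneg)
  then have "(fact (n - 1) * \<bar>sym_rem n f x y\<bar>) powr p \<le> (A powr (1 / p) * B powr (1 / q)) powr p"
    using pq by (intro powr_mono2) auto
  also have "\<dots> = A * B powr (p / q)"
    using A B pq by (simp add: powr_mult powr_powr mult.commute)
  also have "B powr (p / q) = y powr ((r + 1) * (p / q)) / (r + 1) powr (p / q)"
    using y r by (simp add: B_def powr_divide powr_powr)
  also have "(r + 1) * (p / q) = p * real n - 1"
  proof -
    have "p / q = p - 1"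
      using pq by (simp add: field_simps)
    moreover have "(r + 1) * (p / q) = p * (real n - 1) + p / q"
      using pq by (simp add: r_def field_simps)
    ultimately show ?thesis
      by (simp add: algebra_simps)
  qed
  finally have "fact (n - 1) powr p * \<bar>sym_rem n f x y\<bar> powr p
      \<le> A * (y powr (p * real n - 1) / (r + 1) powr (p / q))"
    by (simp add: powr_mult)
  then have "\<bar>sym_rem n f x y\<bar> powr p
      \<le> A * (y powr (p * real n - 1) / (r + 1) powr (p / q)) / fact (n - 1) powr p"
    by (subst pos_le_divide_eq) (simp_all add: mult.commute)
  then have "\<bar>sym_rem n f x y\<bar> powr p
      \<le> y powr (p * real n - 1) / (fact (n - 1) powr p * (r + 1) powr (p / q)) * A"
    by (simp add: mult_ac)
  then show ?thesis
    unfolding A(2) r_def[symmetric] using A(1) by (simp add: ennreal_mult'[symmetric] ennreal_leI)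
qed

context
  fixes b \<xi> p q :: real and a n :: nat and f :: "real \<Rightarrow> real"
  assumes a: "a \<ge> 1" and b: "b > (real n + 1) / (2 * real a)" and \<xi>: "\<xi> > 0"
    and f: "Cn n f" and n: "n \<ge> 2" "even n"
    and pq: "p > 1" "q > 1" "1 / p + 1 / q = 1"
    and phi: "memLp p ((deriv ^^ n) f)"
begin

text \<open>Hoelder in y with half of the weight in each factor. The second factor to the power q is
  the weight with exponent qb/2, whose zeroth half-line moment is the bracket raised to p/q.\<close>

lemma Kfun_powr_le:
  "ennreal (\<bar>Kfun a b n \<xi> f x\<bar> powr p)
    \<le> ennreal (Wconst a b \<xi> powr p * (\<xi> powr (1 - real a * q * b) *
        (Gamma (1 / (2 * real a)) * Gamma (q * b / 2 - 1 / (2 * real a)) / (2 * real a * Gamma (q * b / 2)))) powr (p / q))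
      * (\<integral>\<^sup>+y. ennreal (indicator {0<..} y * (\<bar>sym_rem n f x y\<bar> powr p / (y ^ (2 * a) + \<xi> ^ (2 * a)) powr (p * b / 2))) \<partial>lborel)"
  (is "_ \<le> ennreal (?W powr p * ?m powr (p / q)) * ?E")
proof (cases "?E = top")
  have b1: "b > 1 / (2 * real a)"
    using a n by (intro le_less_trans[OF _ b] divide_right_mono) auto
  moreover have "0 < 1 / (2 * real a)"
    using a by simp
  ultimately have b_pos: "b > 0"
    by (rule less_trans[rotated])
  have "b < q * b"
    using pq b_pos by simp
  \<comment> \<open>This is finiteness of that zeroth moment: b exceeds (n + 1)/(2a), which is at
    least 2/(2a), and q > 1.\<close>
  have "1 / (2 * real a) < q * b / 2"
  proof -
    have "1 / (2 * real a) = (1 + 1) / (2 * real a) / 2"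
      using a by simp
    also have "\<dots> \<le> (real n + 1) / (2 * real a) / 2"
      using n by (intro divide_right_mono) auto
    also have "\<dots> < q * b / 2"
      by (rule divide_strict_right_mono[OF order_less_trans[OF b \<open>b < q * b\<close>]]) simp
    finally show ?thesis .
  qed
  then have gam: "Gamma (q * b / 2 - 1 / (2 * real a)) > 0" "Gamma (q * b / 2) > 0" "Gamma (1 / (2 * real a)) > 0"
    "Gamma (b - 1 / (2 * real a)) > 0" "Gamma b > 0"
    using a b1 pq b_pos by (auto intro!: Gamma_real_pos)
  have W: "?W > 0"
    unfolding Wconst_def using gam a \<xi> by auto
  have m: "?m > 0"
    using gam a \<xi> by auto
  {
    case True
    \<comment> \<open>In \<open>ennreal\<close> the product of 0 and \<open>top\<close> is 0, so the
      coefficient must be strictly positive for the right-hand side to be infinite.\<close>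
    have "?W powr p * ?m powr (p / q) > 0"
      using W m by (metis mult_pos_pos powr_gt_zero less_irrefl)
    then have "ennreal (?W powr p * ?m powr (p / q)) \<noteq> 0"
      by (simp only: ennreal_eq_0_iff not_le)
    then show ?thesis
      unfolding True by (simp only: ennreal_mult_top if_False top_greatest)
  next
    case False
    then obtain A where A: "A \<ge> 0" "?E = ennreal A"
      by (cases ?E) auto
    have f_meas [measurable]: "f \<in> borel_measurable borel"
      using Cn_continuous(2)[OF f, of 0] by simp
    have R_meas [measurable]: "sym_rem n f x \<in> borel_measurable borel"
      unfolding sym_rem_def by measurable
    let ?w = "\<lambda>y. y ^ (2 * a) + \<xi> ^ (2 * a)"
    have w: "?w y > 0" for y
      using \<xi> by (simp add: add_nonneg_pos)
    define F where "F y = indicator {0<..} y * (\<bar>sym_rem n f x y\<bar> / ?w y powr (b / 2))" for y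
    define G where "G y = indicator {0<..} y / ?w y powr (b / 2)" for y
    have FG: "F y * G y = \<bar>indicator {0<..} y * (sym_rem n f x y / ?w y powr b)\<bar>" for y
      using w[of y] by (simp add: F_def G_def indicator_def abs_mult flip: powr_add)
    have "(\<integral>\<^sup>+y. ennreal (F y * G y) \<partial>lborel) \<le> ennreal (A powr (1 / p) * ?m powr (1 / q))"
    proof (rule nn_integral_Holder[OF pq])
      have "F y powr p = indicator {0<..} y * (\<bar>sym_rem n f x y\<bar> powr p / ?w y powr (p * b / 2))" for y
        using w[of y] by (simp add: F_def indicator_def powr_divide powr_powr mult.commute)
      then show "(\<integral>\<^sup>+y. ennreal (F y powr p) \<partial>lborel) \<le> ennreal A"
        using A by simp
      have "G y powr q = indicator {0<..} y * (y ^ 0 / ?w y powr (q * b / 2))" for y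
        using w[of y] by (simp add: G_def indicator_def powr_divide powr_powr mult.commute)
      moreover have "has_bochner_integral lborel (\<lambda>y. indicator {0<..} y * (y ^ 0 / ?w y powr (q * b / 2))) ?m"
        using has_bochner_integral_moment[OF a _ \<xi>, of 0 "q * b / 2"] \<open>1 / (2 * real a) < q * b / 2\<close>
        by (simp add: mult.assoc)
      then have "(\<integral>\<^sup>+y. ennreal (indicator {0<..} y * (y ^ 0 / ?w y powr (q * b / 2))) \<partial>lborel) = ennreal ?m"
        by (subst nn_integral_eq_integral) (auto simp: has_bochner_integral_iff)
      ultimately show "(\<integral>\<^sup>+y. ennreal (G y powr q) \<partial>lborel) \<le> ennreal ?m"
        by simp
    qed (use A m in \<open>auto simp: F_def G_def\<close>)
    \<comment> \<open>If the integrand is not integrable, the Bochner integral is 0 by convention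
      and the inequality is trivial.\<close>
    moreover have "ennreal \<bar>\<integral>y. indicator {0<..} y * (sym_rem n f x y / ?w y powr b) \<partial>lborel\<bar> \<le> (\<integral>\<^sup>+y. ennreal (F y * G y) \<partial>lborel)"
      unfolding FG
      using integral_norm_bound_ennreal[of lborel "\<lambda>y. indicator {0<..} y * (sym_rem n f x y / ?w y powr b)"]
        not_integrable_integral_eq[of lborel "\<lambda>y. indicator {0<..} y * (sym_rem n f x y / ?w y powr b)"]
      by (cases "integrable lborel (\<lambda>y. indicator {0<..} y * (sym_rem n f x y / ?w y powr b))") auto
    ultimately have "\<bar>\<integral>y. indicator {0<..} y * (sym_rem n f x y / ?w y powr b) \<partial>lborel\<bar> \<le> A powr (1 / p) * ?m powr (1 / q)"
      by (meson order_trans ennreal_le_iff powr_ge_zero mult_nonneg_nonneg)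
    moreover have "Kfun a b n \<xi> f x = ?W * (\<integral>y. indicator {0<..} y * (sym_rem n f x y / ?w y powr b) \<partial>lborel)"
      using n pq by (intro Kfun_eq[where p = p] a b \<xi> f phi) auto
    ultimately have "\<bar>Kfun a b n \<xi> f x\<bar> \<le> ?W * (A powr (1 / p) * ?m powr (1 / q))"
      using W by (simp add: abs_mult)
    then have "\<bar>Kfun a b n \<xi> f x\<bar> powr p \<le> (?W * (A powr (1 / p) * ?m powr (1 / q))) powr p"
      using pq by (intro powr_mono2) auto
    also have "\<dots> = ?W powr p * ?m powr (p / q) * A"
      using A pq by (simp add: powr_mult powr_powr mult_ac)
    finally show ?thesis
      using A by (simp flip: ennreal_mult')
  }
qed

end

section \<open>The constant\<close>

lemma one_plus_powr_le:
  assumes "r \<ge> 0" "u \<ge> (0::real)"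
  shows "(1 + u) powr r \<le> 2 powr r * (1 + u powr r)"
proof -
  have "(1 + u) powr r \<le> (2 * max 1 u) powr r"
    using assms by (intro powr_mono2) auto
  also have "\<dots> = 2 powr r * max 1 u powr r"
    by (simp add: powr_mult)
  also have "\<dots> \<le> 2 powr r * (1 + u powr r)"
    by (intro mult_left_mono) (auto simp: max_def)
  finally show ?thesis .
qed

text \<open>On the half-line the integrand is at most 2^(2p+1) times the sum of two Beta-type
  integrands, with s = pn and s = pn + 2p + 1; the larger s is finite exactly under the hypothesis
  on b, rewritten as \<open>pb\<close>. As for positivity, the integrand is positive for u > 0, so a
  zero integral would make the interval (0, 1) a null set.\<close>

lemma
  assumes p: "p \<ge> 1" and n: "n \<ge> 1" and a: "a \<ge> 1"
    and b: "b > (1 / real a) * (1 / p + real n + 2)"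
  shows set_integrable_tau: "set_integrable lborel {0<..} (tau_integrand p n a b)"
    and tau_tilde_pos: "0 < tau_tilde p n a b"
proof -
  define W where "W s u = indicator {0<..} u * (u powr (s - 1) / (1 + u ^ (2 * a)) powr (p * b / 2))" for s u :: real
  have pb: "(p * real n + 2 * p + 1) / (2 * real a) < p * b / 2"
  proof -
    have "(p * real n + 2 * p + 1) / (2 * real a) = p * ((1 / real a) * (1 / p + real n + 2)) / 2"
      using p a by (simp add: field_simps)
    also have "\<dots> < p * b / 2"
      using b p by (intro divide_strict_right_mono mult_strict_left_mono) auto
    finally show ?thesis .
  qed
  have W: "integrable lborel (W s)" if "0 < s" "s \<le> p * real n + 2 * p + 1" for s
  proof -
    have "s / (2 * real a) < p * b / 2"
      using that a by (intro le_less_trans[OF _ pb] divide_right_mono) auto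
    from has_bochner_integral_powr_weight_1[OF a that(1) this] show ?thesis
      by (simp add: W_def[abs_def] has_bochner_integral_iff)
  qed
  have [measurable]: "tau_integrand p n a b \<in> borel_measurable borel"
    unfolding tau_integrand_def by measurable
  have pos: "0 < tau_integrand p n a b u" if "u > 0" for u
  proof -
    have "1 < (1 + u) powr (2 * p + 1)"
      using that p by (intro gr_one_powr) auto
    moreover have "0 < 1 + u ^ (2 * a)"
      using that by (simp add: add_pos_nonneg)
    ultimately show ?thesis
      using that by (simp add: tau_integrand_def)
  qed
  have "integrable lborel (\<lambda>u. indicator {0<..} u * tau_integrand p n a b u)"
  proof (rule Bochner_Integration.integrable_bound)
    show "integrable lborel (\<lambda>u. 2 powr (2 * p + 1) * (W (p * real n) u + W (p * real n + 2 * p + 1) u))"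
      using p n by (intro integrable_mult_right Bochner_Integration.integrable_add W) (auto simp: add_pos_nonneg)
    have "norm (indicator {0<..} u * tau_integrand p n a b u)
        \<le> norm (2 powr (2 * p + 1) * (W (p * real n) u + W (p * real n + 2 * p + 1) u))" for u
    proof (cases "u > 0")
      case True
      let ?c = "u powr (p * real n - 1) / (1 + u ^ (2 * a)) powr (p * b / 2)"
      have "tau_integrand p n a b u = ((1 + u) powr (2 * p + 1) - 1) * ?c"
        by (simp add: tau_integrand_def)
      also have "\<dots> \<le> (2 powr (2 * p + 1) * (1 + u powr (2 * p + 1))) * ?c"
        using one_plus_powr_le[of "2 * p + 1" u] p True by (intro mult_right_mono) auto
      also have "\<dots> = 2 powr (2 * p + 1) * (?c + (u powr (2 * p + 1) * u powr (p * real n - 1)) / (1 + u ^ (2 * a)) powr (p * b / 2))"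
        by (simp add: algebra_simps)
      also have "u powr (2 * p + 1) * u powr (p * real n - 1) = u powr (p * real n + 2 * p + 1 - 1)"
        by (simp flip: powr_add add: algebra_simps)
      finally show ?thesis
        using True less_imp_le[OF pos[OF True]] by (simp add: W_def)
    qed auto
    then show "AE u in lborel. norm (indicator {0<..} u * tau_integrand p n a b u)
        \<le> norm (2 powr (2 * p + 1) * (W (p * real n) u + W (p * real n + 2 * p + 1) u))"
      by simp
  qed measurable
  then show int: "set_integrable lborel {0<..} (tau_integrand p n a b)"
    by (simp add: set_integrable_def)
  have nonneg: "0 \<le> indicator {0<..} u * tau_integrand p n a b u" for u
    using pos[of u] by (auto simp: indicator_def)
  have "tau_tilde p n a b \<noteq> 0"
  proof
    assume "tau_tilde p n a b = 0"
    then have "AE u in lborel. indicator {0<..} u * tau_integrand p n a b u = 0"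
      using int nonneg unfolding tau_tilde_def set_integrable_def
      by (subst (asm) integral_nonneg_eq_0_iff_AE) auto
    then have "AE u in lborel. u \<notin> {0<..<1::real}"
      by eventually_elim (use pos in force)
    then have "{0<..<1::real} \<in> null_sets lborel"
      by (subst AE_iff_null_sets) auto
    then show False
      by (simp add: null_sets_def)
  qed
  moreover have "0 \<le> tau_tilde p n a b"
    unfolding tau_tilde_def by (intro integral_nonneg_AE) (use nonneg in auto)
  ultimately show "0 < tau_tilde p n a b" by simp
qed

section \<open>The integrals in y and t, and collection of the constants\<close>

lemma nn_integral_tau_scaled:
  assumes p: "p \<ge> 1" and n: "n \<ge> 1" and a: "a \<ge> 1"
    and b: "b > (1 / real a) * (1 / p + real n + 2)" and \<xi>: "\<xi> > 0"
  shows "(\<integral>\<^sup>+y. ennreal (indicator {0<..} y * (((1 + y / \<xi>) powr (2 * p + 1) - 1) * y powr (p * real n - 1)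
      / (y ^ (2 * a) + \<xi> ^ (2 * a)) powr (p * b / 2))) \<partial>lborel)
    = ennreal (\<xi> powr (p * real n - real a * p * b) * tau_tilde p n a b)"
    (is "(\<integral>\<^sup>+y. ennreal (?f y) \<partial>lborel) = _")
proof -
  define c where "c = \<xi> powr (p * real n - 1 - real a * p * b)"
  have *: "?f (0 + \<xi> * u) = c * (indicator {0<..} u * tau_integrand p n a b u)" for u
  proof (cases "u > 0")
    case True
    have "(\<xi> * u) ^ (2 * a) + \<xi> ^ (2 * a) = \<xi> powr (2 * real a) * (1 + u ^ (2 * a))"
      using \<xi> powr_realpow[of \<xi> "2 * a"] by (simp add: power_mult_distrib distrib_left)
    then have "((\<xi> * u) ^ (2 * a) + \<xi> ^ (2 * a)) powr (p * b / 2) = \<xi> powr (real a * p * b) * (1 + u ^ (2 * a)) powr (p * b / 2)"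
      by (simp add: powr_mult powr_powr mult.assoc)
    moreover have "(\<xi> * u) powr (p * real n - 1) = \<xi> powr (p * real n - 1) * u powr (p * real n - 1)"
      using \<xi> True by (simp add: powr_mult)
    moreover have "c = \<xi> powr (p * real n - 1) / \<xi> powr (real a * p * b)"
      unfolding c_def by (rule powr_diff)
    ultimately show ?thesis
      using \<xi> True by (simp add: tau_integrand_def)
  qed (use \<xi> in \<open>simp add: zero_less_mult_iff\<close>)
  have int: "integrable lborel (\<lambda>u. indicator {0<..} u * tau_integrand p n a b u)"
    using set_integrable_tau[OF p n a b] by (simp add: set_integrable_def)
  have "0 \<le> indicator {0<..} u * tau_integrand p n a b u" for u
    using ge_one_powr_ge_zero[of "1 + u" "2 * p + 1"] p
    by (auto simp: tau_integrand_def indicator_def)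
  then have nn: "(\<integral>\<^sup>+u. ennreal (c * (indicator {0<..} u * tau_integrand p n a b u)) \<partial>lborel) = ennreal (c * tau_tilde p n a b)"
    using int by (subst nn_integral_eq_integral) (auto simp: tau_tilde_def c_def)
  have "(\<integral>\<^sup>+y. ennreal (?f y) \<partial>lborel) = ennreal \<xi> * (\<integral>\<^sup>+u. ennreal (?f (0 + \<xi> * u)) \<partial>lborel)"
    using \<xi> by (subst nn_integral_real_affine[of _ \<xi> 0]) auto
  also have "\<dots> = ennreal (\<xi> * (c * tau_tilde p n a b))"
    unfolding * nn using \<xi> by (simp add: ennreal_mult')
  also have "\<xi> * (c * tau_tilde p n a b) = \<xi> powr (p * real n - real a * p * b) * tau_tilde p n a b"
    using \<xi> powr_add[of \<xi> 1 "p * real n - 1 - real a * p * b"] by (simp add: c_def)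
  finally show ?thesis .
qed

text \<open>With r = 2p this is the t-integral of the growth factor of the modulus. The
  antiderivative taken between 0 and y produces both the -1 inside \<tau> and the factor 2p + 1 of
  the bound.\<close>

lemma nn_integral_one_plus_powr:
  assumes r: "r \<ge> 0" and \<xi>: "\<xi> > 0" and y: "y \<ge> (0::real)"
  shows "(\<integral>\<^sup>+t. ennreal (indicator {0..y} t * (1 + t / \<xi>) powr r) \<partial>lborel)
    = ennreal (\<xi> / (r + 1) * ((1 + y / \<xi>) powr (r + 1) - 1))"
proof (rule nn_integral_has_integral_lebesgue)
  have "((\<lambda>t. (1 + t / \<xi>) powr r) has_integral
      (\<xi> / (r + 1) * (1 + y / \<xi>) powr (r + 1) - \<xi> / (r + 1) * (1 + 0 / \<xi>) powr (r + 1))) {0..y}"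
  proof (rule fundamental_theorem_of_calculus[OF y])
    fix t assume "t \<in> {0..y}"
    then have t: "0 < 1 + t / \<xi>"
      using \<xi> by (intro add_pos_nonneg) auto
    have "((\<lambda>t. 1 + t / \<xi>) has_field_derivative 1 / \<xi>) (at t within {0..y})"
      using \<xi> by (auto intro!: derivative_eq_intros)
    from DERIV_cmult[OF DERIV_chain2[OF has_real_derivative_powr[OF t, of "r + 1"] this], of "\<xi> / (r + 1)"]
    show "((\<lambda>t. \<xi> / (r + 1) * (1 + t / \<xi>) powr (r + 1)) has_vector_derivative (1 + t / \<xi>) powr r) (at t within {0..y})"
      using r \<xi> by (simp add: has_real_derivative_iff_has_vector_derivative)
  qed
  then show "((\<lambda>t. (1 + t / \<xi>) powr r) has_integral \<xi> / (r + 1) * ((1 + y / \<xi>) powr (r + 1) - 1)) {0..y}"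
    by (simp add: right_diff_distrib)
qed auto

text \<open>Everything is expressed through p/q = p - 1. In W^p times the moment to the power p - 1,
  the factors a^p and a^(1-p) leave a single a, and those of Gamma(1/(2a)) leave its inverse; this
  explains the p-th roots of both in the bound. The assumption on b makes all Gamma arguments
  positive.\<close>

lemma bound_const_powr:
  fixes b \<xi> p q :: real and a n :: nat
  assumes a: "a \<ge> 1" and b: "b > 1 / real a" and \<xi>: "\<xi> > 0" and n: "n \<ge> 1"
    and pq: "p > 1" "q > 1" "1 / p + 1 / q = 1"
    and tau: "0 < tau_tilde p n a b" and \<omega>: "\<omega> \<ge> 0"
  shows "Wconst a b \<xi> powr p * (\<xi> powr (1 - real a * q * b) *
        (Gamma (1 / (2 * real a)) * Gamma (q * b / 2 - 1 / (2 * real a)) / (2 * real a * Gamma (q * b / 2)))) powr (p / q)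
      * (1 / (fact (n - 1) powr p * (q * (real n - 1) + 1) powr (p / q)) * \<omega> powr p * (\<xi> / (2 * p + 1))
      * (\<xi> powr (p * real n - real a * p * b) * tau_tilde p n a b))
    = (bound_const p q n a b * \<xi> ^ n * \<omega>) powr p"
proof -
  define A where "A = real a"
  define G1 where "G1 = Gamma (1 / (2 * A))"
  define G2 where "G2 = Gamma (b - 1 / (2 * A))"
  define G3 where "G3 = Gamma (q * b / 2 - 1 / (2 * A))"
  define G4 where "G4 = Gamma (q * b / 2)"
  define G5 where "G5 = Gamma b"
  define T where "T = tau_tilde p n a b"
  define s where "s = q * (real n - 1) + 1"
  define F where "F = (fact (n - 1) :: real)"
  have A: "A > 0"
    using a by (simp add: A_def)
  have bA: "0 < 1 / A" "1 / A < b"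
    using A b by (auto simp: A_def)
  then have "0 < b"
    by linarith
  then have "b < q * b"
    using pq by simp
  moreover have "1 / (2 * A) = (1 / A) / 2"
    by simp
  ultimately have lt: "0 < b" "1 / (2 * A) < b" "1 / (2 * A) < q * b / 2" "0 < q * b / 2"
    using bA by linarith+
  have G: "0 < G1" "0 < G2" "0 < G3" "0 < G4" "0 < G5"
    unfolding G1_def G2_def G3_def G4_def G5_def
    using lt A by (auto intro!: Gamma_real_pos)
  have pos: "T > 0" "s > 0" "F > 0" "2 * p + 1 > 0"
    using tau pq n by (auto simp: T_def s_def F_def add_nonneg_pos)
  have r: "p / q = p - 1"
    using pq by (simp add: field_simps)
  have pm: "z powr p = z * z powr (p - 1)" if "z > 0" for z :: real
    using that by (simp add: powr_diff)
  \<comment> \<open>The four exponents belong to W, to the moment, to the t-integral and to the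
    scaled \<tau> integral. By q(p-1) = p all terms with b cancel and np remains.\<close>
  have e: "\<xi> powr ((2 * A * b - 1) * p) * \<xi> powr ((1 - A * q * b) * (p - 1)) * \<xi> * \<xi> powr (p * real n - A * p * b) = \<xi> powr (real n * p)"
  proof -
    have "q * (p - 1) = p"
      using pq by (simp add: field_simps)
    then have "A * b * (q * (p - 1)) = A * b * p"
      by simp
    then have "(2 * A * b - 1) * p + (1 - A * q * b) * (p - 1) + 1 + (p * real n - A * p * b) = real n * p"
      by (simp add: algebra_simps)
    moreover have "\<xi> = \<xi> powr 1"
      using \<xi> by simp
    ultimately show ?thesis
      by (metis powr_add)
  qed
  have "Wconst a b \<xi> powr p = G5 powr p * A powr p * \<xi> powr ((2 * A * b - 1) * p) / (G1 powr p * G2 powr p)"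
    using G A \<xi> by (simp add: Wconst_def powr_mult powr_divide powr_powr flip: G1_def G2_def G5_def A_def)
  moreover have "(\<xi> powr (1 - A * q * b) * (G1 * G3 / (2 * A * G4))) powr (p / q)
      = \<xi> powr ((1 - A * q * b) * (p - 1)) * (G1 powr (p - 1) * G3 powr (p - 1) / (2 powr (p - 1) * A powr (p - 1) * G4 powr (p - 1)))"
    unfolding r using G A \<xi> by (simp add: powr_mult powr_divide powr_powr)
  moreover have "(bound_const p q n a b * \<xi> ^ n * \<omega>) powr p
      = T * A * G3 powr (p - 1) / (2 powr (p - 1) * G1 * G2 powr p * G4 powr (p - 1) * s powr (p - 1) * (2 * p + 1))
        * (G5 powr p / F powr p) * \<xi> powr (real n * p) * \<omega> powr p"
  proof -
    have "(z powr (1 / q)) powr p = z powr (p - 1)" for z :: real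
      by (simp add: powr_powr flip: r)
    moreover have "(z powr (1 / p)) powr p = z" if "z > 0" for z :: real
      using that pq by (simp add: powr_powr)
    ultimately show ?thesis
      using G A pos \<xi> \<omega>
      by (simp add: bound_const_def F_def powr_mult powr_divide powr_powr flip: powr_realpow T_def G1_def G2_def G3_def G4_def G5_def A_def s_def)
  qed
  ultimately show ?thesis
    unfolding T_def[symmetric] G1_def[symmetric] G2_def[symmetric] G3_def[symmetric] G4_def[symmetric] G5_def[symmetric]
      A_def[symmetric] s_def[symmetric] F_def[symmetric] r e[symmetric]
    using G A pos \<xi> by (simp add: pm[of A] pm[of G1] mult_ac)
qed

section \<open>The norm bound\<close>

lemma borel_measurable_Kfun:
  assumes "Cn n f"
  shows "Kfun a b n \<xi> f \<in> borel_measurable borel"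
proof -
  have [measurable]: "f \<in> borel_measurable borel"
    using Cn_continuous(2)[OF assms, of 0] by simp
  have [measurable]: "(deriv ^^ (2 * \<rho>)) f \<in> borel_measurable borel" if "\<rho> \<in> {1..n div 2}" for \<rho>
    using that by (intro Cn_continuous(2)[OF assms]) auto
  have "Mop a b \<xi> f \<in> borel_measurable borel"
    unfolding Mop_def by measurable
  then show ?thesis
    unfolding Kfun_def
    by (intro borel_measurable_diff borel_measurable_sum borel_measurable_times borel_measurable_divide) auto
qed

text \<open>Translation invariance removes the centring, so after integration in x only t matters;
  the square of 1 + t/\<xi> becomes the power 2p.\<close>

lemma nn_integral_Delta2_centered_le:
  assumes p: "p \<ge> 1" and g: "memLp p g" and \<xi>: "\<xi> > 0" and t: "t \<ge> 0"
  shows "(\<integral>\<^sup>+x. ennreal (\<bar>Delta2 t g (x - t)\<bar> powr p) \<partial>lborel)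
    \<le> ennreal (omega2 p g \<xi> powr p * (1 + t / \<xi>) powr (2 * p))"
proof -
  note D = memLp_translate[OF memLp_Delta2_mem[OF p g, of t], of "- t"]
  have "1 + t / \<xi> > 0"
    using t \<xi> by (simp add: add_pos_nonneg)
  then have "(1 + t / \<xi>)\<^sup>2 powr p = (1 + t / \<xi>) powr (2 * p)"
    by (simp add: powr_powr flip: powr_numeral)
  have "(\<integral>\<^sup>+x. ennreal (\<bar>Delta2 t g (x - t)\<bar> powr p) \<partial>lborel) = ennreal (Lp_norm p (Delta2 t g) powr p)"
    using memLp_nn_integral[OF D(1)] D(2) p by simp
  also have "Lp_norm p (Delta2 t g) powr p \<le> ((1 + t / \<xi>)\<^sup>2 * omega2 p g \<xi>) powr p"
    using p by (intro powr_mono2 Lp_norm_Delta2_le g \<xi> t) auto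
  also have "\<dots> = omega2 p g \<xi> powr p * (1 + t / \<xi>) powr (2 * p)"
    using omega2_nonneg[OF p g, of \<xi>] \<xi> \<open>(1 + t / \<xi>)\<^sup>2 powr p = _\<close> by (simp add: powr_mult)
  finally show ?thesis
    by (simp add: ennreal_leI)
qed

text \<open>Both applications of Hoelder bound the p-th power of K at x by a double integral in y
  and t. Tonelli moves x innermost, where the modulus replaces the second difference; the remaining
  t- and y-integrals are explicit.\<close>

lemma Kfun_nn_integral_le:
  fixes b \<xi> p q :: real and a n :: nat and f :: "real \<Rightarrow> real"
  assumes a: "a \<ge> 1" and b: "b > (1 / real a) * (1 / p + real n + 2)" and \<xi>: "\<xi> > 0"
    and f: "Cn n f" and n: "n \<ge> 2" "even n"
    and pq: "p > 1" "q > 1" "1 / p + 1 / q = 1"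
    and phi: "memLp p ((deriv ^^ n) f)"
  shows "(\<integral>\<^sup>+x. ennreal (\<bar>Kfun a b n \<xi> f x\<bar> powr p) \<partial>lborel)
    \<le> ennreal ((bound_const p q n a b * \<xi> ^ n * omega2 p ((deriv ^^ n) f) \<xi>) powr p)"
proof -
  let ?g = "(deriv ^^ n) f"
  let ?w = "\<lambda>y::real. (y ^ (2 * a) + \<xi> ^ (2 * a)) powr (p * b / 2)"
  define \<omega> where "\<omega> = omega2 p ?g \<xi>"
  define c where "c = Wconst a b \<xi> powr p * (\<xi> powr (1 - real a * q * b) *
        (Gamma (1 / (2 * real a)) * Gamma (q * b / 2 - 1 / (2 * real a)) / (2 * real a * Gamma (q * b / 2)))) powr (p / q)"
  define d where "d = 1 / (fact (n - 1) powr p * (q * (real n - 1) + 1) powr (p / q))"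
  define V where "V y = indicator {0<..} y * (d * y powr (p * real n - 1) / ?w y)" for y
  \<comment> \<open>This is the indicator of \<open>{0..y}\<close> with a moving endpoint, in a form
    whose joint measurability in y and t is that of two comparisons, as Tonelli requires.\<close>
  define J where "J y t = (if 0 \<le> t \<and> t \<le> y then 1 else 0 :: real)" for y t :: real
  define H where "H x y t = ennreal (V y) * ennreal (J y t * \<bar>Delta2 t ?g (x - t)\<bar> powr p)" for x y t
  have p: "p \<ge> 1" and n1: "n \<ge> 1"
    using pq n by auto
  have p_inv: "0 \<le> 1 / p"
    using pq by simp
  then have "(1 / real a) * 1 \<le> (1 / real a) * (1 / p + real n + 2)"
    by (intro mult_left_mono) auto
  then have b1: "b > 1 / real a"
    using b by linarith
  have bn: "b > (real n + 1) / (2 * real a)"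
  proof (rule le_less_trans[OF _ b])
    have "(real n + 1) / (2 * real a) = (1 / real a) * ((real n + 1) / 2)"
      by simp
    also have "\<dots> \<le> (1 / real a) * (1 / p + real n + 2)"
      using p_inv by (intro mult_left_mono) auto
    finally show "(real n + 1) / (2 * real a) \<le> (1 / real a) * (1 / p + real n + 2)" .
  qed
  have c: "c \<ge> 0" and d: "d \<ge> 0"
    by (auto simp: c_def d_def)
  have \<omega>: "\<omega> \<ge> 0"
    unfolding \<omega>_def using \<xi> by (intro omega2_nonneg p phi) auto
  have V: "V y \<ge> 0" for y
    using d by (simp add: V_def)
  have J: "J y = indicator {0..y}" for y
    by (auto simp: J_def indicator_def)
  have meas [measurable]: "?g \<in> borel_measurable borel"
    by (rule Cn_continuous(2)[OF f order_refl])
  have Delta_meas [measurable]: "(\<lambda>(x, t). Delta2 t ?g (x - t)) \<in> borel_measurable (borel \<Otimes>\<^sub>M borel)"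
    unfolding Delta2_def by measurable
  have V_meas [measurable]: "V \<in> borel_measurable borel"
    unfolding V_def by measurable
  have "(\<integral>\<^sup>+x. \<integral>\<^sup>+y. \<integral>\<^sup>+t. H x y t \<partial>lborel \<partial>lborel \<partial>lborel) = (\<integral>\<^sup>+y. \<integral>\<^sup>+x. \<integral>\<^sup>+t. H x y t \<partial>lborel \<partial>lborel \<partial>lborel)"
    unfolding H_def J_def by (rule lborel_pair.Fubini') measurable
  also have "\<dots> = (\<integral>\<^sup>+y. \<integral>\<^sup>+t. \<integral>\<^sup>+x. H x y t \<partial>lborel \<partial>lborel \<partial>lborel)"
    unfolding H_def J_def by (intro nn_integral_cong lborel_pair.Fubini') measurable
  also have "\<dots> \<le> (\<integral>\<^sup>+y. ennreal (d * \<omega> powr p * (\<xi> / (2 * p + 1))) * ennreal (indicator {0<..} y *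
      (((1 + y / \<xi>) powr (2 * p + 1) - 1) * y powr (p * real n - 1) / ?w y)) \<partial>lborel)"
  proof (rule nn_integral_mono)
    fix y
    show "(\<integral>\<^sup>+t. \<integral>\<^sup>+x. H x y t \<partial>lborel \<partial>lborel) \<le> ennreal (d * \<omega> powr p * (\<xi> / (2 * p + 1))) * ennreal (indicator {0<..} y *
      (((1 + y / \<xi>) powr (2 * p + 1) - 1) * y powr (p * real n - 1) / ?w y))"
    proof (cases "y > 0")
      case True
      have "(\<integral>\<^sup>+t. \<integral>\<^sup>+x. H x y t \<partial>lborel \<partial>lborel)
          \<le> (\<integral>\<^sup>+t. ennreal (V y * \<omega> powr p) * ennreal (indicator {0..y} t * (1 + t / \<xi>) powr (2 * p)) \<partial>lborel)"
      proof (rule nn_integral_mono)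
        fix t
        show "(\<integral>\<^sup>+x. H x y t \<partial>lborel) \<le> ennreal (V y * \<omega> powr p) * ennreal (indicator {0..y} t * (1 + t / \<xi>) powr (2 * p))"
        proof (cases "t \<in> {0..y}")
          case t: True
          have "(\<integral>\<^sup>+x. H x y t \<partial>lborel) = ennreal (V y) * (\<integral>\<^sup>+x. ennreal (\<bar>Delta2 t ?g (x - t)\<bar> powr p) \<partial>lborel)"
            unfolding H_def J using t by (simp add: nn_integral_cmult)
          also have "\<dots> \<le> ennreal (V y) * ennreal (\<omega> powr p * (1 + t / \<xi>) powr (2 * p))"
            unfolding \<omega>_def using t by (intro mult_left_mono nn_integral_Delta2_centered_le p phi \<xi>) auto
          also have "\<dots> = ennreal (V y * \<omega> powr p) * ennreal (indicator {0..y} t * (1 + t / \<xi>) powr (2 * p))"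
            using t V[of y] by (simp add: ennreal_mult' mult.assoc)
          finally show ?thesis .
        qed (auto simp: H_def J)
      qed
      also have "\<dots> = ennreal (V y * \<omega> powr p) * ennreal (\<xi> / (2 * p + 1) * ((1 + y / \<xi>) powr (2 * p + 1) - 1))"
        using True p \<xi> nn_integral_one_plus_powr[of "2 * p" \<xi> y] by (simp add: nn_integral_cmult)
      also have "\<dots> = ennreal (V y * \<omega> powr p * (\<xi> / (2 * p + 1) * ((1 + y / \<xi>) powr (2 * p + 1) - 1)))"
        using V[of y] by (intro ennreal_mult'[symmetric]) auto
      also have "V y * \<omega> powr p * (\<xi> / (2 * p + 1) * ((1 + y / \<xi>) powr (2 * p + 1) - 1))
          = (d * \<omega> powr p * (\<xi> / (2 * p + 1))) * (indicator {0<..} y *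
              (((1 + y / \<xi>) powr (2 * p + 1) - 1) * y powr (p * real n - 1) / ?w y))"
        by (simp add: V_def mult_ac)
      also have "ennreal \<dots> = ennreal (d * \<omega> powr p * (\<xi> / (2 * p + 1))) * ennreal (indicator {0<..} y *
              (((1 + y / \<xi>) powr (2 * p + 1) - 1) * y powr (p * real n - 1) / ?w y))"
        using d \<xi> p by (intro ennreal_mult') auto
      finally show ?thesis .
    qed (simp add: H_def V_def)
  qed
  also have "\<dots> = ennreal (d * \<omega> powr p * (\<xi> / (2 * p + 1))) * ennreal (\<xi> powr (p * real n - real a * p * b) * tau_tilde p n a b)"
    unfolding nn_integral_tau_scaled[OF p n1 a b \<xi>, symmetric] by (rule nn_integral_cmult) measurable
  finally have triple: "(\<integral>\<^sup>+x. \<integral>\<^sup>+y. \<integral>\<^sup>+t. H x y t \<partial>lborel \<partial>lborel \<partial>lborel)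
      \<le> ennreal (d * \<omega> powr p * (\<xi> / (2 * p + 1))) * ennreal (\<xi> powr (p * real n - real a * p * b) * tau_tilde p n a b)" .
  have X: "0 \<le> d * \<omega> powr p * (\<xi> / (2 * p + 1))"
    using d \<xi> p by simp
  have "(\<integral>\<^sup>+x. ennreal (\<bar>Kfun a b n \<xi> f x\<bar> powr p) \<partial>lborel) \<le> (\<integral>\<^sup>+x. ennreal c * (\<integral>\<^sup>+y. \<integral>\<^sup>+t. H x y t \<partial>lborel \<partial>lborel) \<partial>lborel)"
  proof (rule nn_integral_mono)
    fix x
    have "ennreal (indicator {0<..} y * (\<bar>sym_rem n f x y\<bar> powr p / ?w y)) \<le> (\<integral>\<^sup>+t. H x y t \<partial>lborel)" for y
    proof (cases "y > 0")
      case True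
      have "ennreal (indicator {0<..} y * (\<bar>sym_rem n f x y\<bar> powr p / ?w y))
          = ennreal (1 / ?w y) * ennreal (\<bar>sym_rem n f x y\<bar> powr p)"
        using True by (simp flip: ennreal_mult')
      also have "\<dots> \<le> ennreal (1 / ?w y) * (ennreal (y powr (p * real n - 1) * d)
          * (\<integral>\<^sup>+t. ennreal (indicator {0..y} t * \<bar>Delta2 t ?g (x - t)\<bar> powr p) \<partial>lborel))"
        using sym_rem_powr_le[OF pq f n True, of x] by (intro mult_left_mono) (auto simp: d_def)
      also have "\<dots> = ennreal (1 / ?w y * (y powr (p * real n - 1) * d))
          * (\<integral>\<^sup>+t. ennreal (indicator {0..y} t * \<bar>Delta2 t ?g (x - t)\<bar> powr p) \<partial>lborel)"
        by (subst ennreal_mult'[of "1 / ?w y"]) (simp_all only: mult.assoc, simp)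
      also have "1 / ?w y * (y powr (p * real n - 1) * d) = V y"
        using True by (simp add: V_def)
      also have "ennreal (V y) * (\<integral>\<^sup>+t. ennreal (indicator {0..y} t * \<bar>Delta2 t ?g (x - t)\<bar> powr p) \<partial>lborel)
          = (\<integral>\<^sup>+t. H x y t \<partial>lborel)"
        unfolding H_def J by (rule nn_integral_cmult[symmetric]) measurable
      finally show ?thesis .
    qed auto
    then have "(\<integral>\<^sup>+y. ennreal (indicator {0<..} y * (\<bar>sym_rem n f x y\<bar> powr p / ?w y)) \<partial>lborel)
        \<le> (\<integral>\<^sup>+y. \<integral>\<^sup>+t. H x y t \<partial>lborel \<partial>lborel)"
      by (intro nn_integral_mono) auto
    then show "ennreal (\<bar>Kfun a b n \<xi> f x\<bar> powr p) \<le> ennreal c * (\<integral>\<^sup>+y. \<integral>\<^sup>+t. H x y t \<partial>lborel \<partial>lborel)"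
      using Kfun_powr_le[OF a bn \<xi> f n pq phi, of x] unfolding c_def[symmetric]
      by (meson mult_left_mono order_trans zero_le)
  qed
  also have "\<dots> = ennreal c * (\<integral>\<^sup>+x. \<integral>\<^sup>+y. \<integral>\<^sup>+t. H x y t \<partial>lborel \<partial>lborel \<partial>lborel)"
    unfolding H_def J_def by (rule nn_integral_cmult) measurable
  also have "\<dots> \<le> ennreal c * (ennreal (d * \<omega> powr p * (\<xi> / (2 * p + 1))) * ennreal (\<xi> powr (p * real n - real a * p * b) * tau_tilde p n a b))"
    by (intro mult_left_mono triple) simp
  also have "\<dots> = ennreal (c * (d * \<omega> powr p * (\<xi> / (2 * p + 1)) * (\<xi> powr (p * real n - real a * p * b) * tau_tilde p n a b)))"
    by (simp only: ennreal_mult'[OF c] ennreal_mult'[OF X])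
  also have "c * (d * \<omega> powr p * (\<xi> / (2 * p + 1)) * (\<xi> powr (p * real n - real a * p * b) * tau_tilde p n a b))
      = (bound_const p q n a b * \<xi> ^ n * \<omega>) powr p"
    unfolding c_def d_def by (intro bound_const_powr a b1 \<xi> n1 pq tau_tilde_pos[OF p n1 a b] \<omega>)
  finally show ?thesis
    by (simp only: \<omega>_def)
qed

lemma Lp_norm_Kfun_le:
  fixes b \<xi> p q :: real and a n :: nat and f :: "real \<Rightarrow> real"
  assumes a: "a \<ge> 1" and b: "b > (1 / real a) * (1 / p + real n + 2)" and \<xi>: "\<xi> > 0"
    and f: "Cn n f" and n: "n \<ge> 2" "even n"
    and pq: "p > 1" "q > 1" "1 / p + 1 / q = 1"
    and phi: "memLp p ((deriv ^^ n) f)"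
  shows memLp_Kfun: "memLp p (Kfun a b n \<xi> f)"
    and Lp_norm_Kfun_le_omega2: "Lp_norm p (Kfun a b n \<xi> f) \<le> bound_const p q n a b * \<xi> ^ n * omega2 p ((deriv ^^ n) f) \<xi>"
    and bound_const_nonneg: "0 \<le> bound_const p q n a b"
proof -
  have p_inv: "0 \<le> 1 / p"
    using pq by simp
  then have "(1 / real a) * 1 \<le> (1 / real a) * (1 / p + real n + 2)"
    by (intro mult_left_mono) auto
  moreover have "0 < 1 / real a"
    using a by simp
  ultimately have b1: "b > 1 / real a" and b0: "b > 0"
    using b by linarith+
  have "1 / (2 * real a) \<le> 1 / real a"
    using a by (simp add: field_simps)
  then have "1 / (2 * real a) < b"
    using b1 by linarith
  then have "Gamma (b - 1 / (2 * real a)) > 0" "Gamma b > 0"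
    using b0 by auto
  then show bc: "0 \<le> bound_const p q n a b"
    using pq by (simp add: bound_const_def)
  have "0 \<le> omega2 p ((deriv ^^ n) f) \<xi>"
    using pq \<xi> by (intro omega2_nonneg phi) auto
  then have nn: "0 \<le> bound_const p q n a b * \<xi> ^ n * omega2 p ((deriv ^^ n) f) \<xi>"
    using bc \<xi> by simp
  have p0: "p > 0"
    using pq by simp
  have "Kfun a b n \<xi> f \<in> borel_measurable lborel"
    using borel_measurable_Kfun[OF f] by simp
  from memLp_boundI[OF this p0 nn Kfun_nn_integral_le[OF a b \<xi> f n pq phi]]
  show "memLp p (Kfun a b n \<xi> f)"
    and "Lp_norm p (Kfun a b n \<xi> f) \<le> bound_const p q n a b * \<xi> ^ n * omega2 p ((deriv ^^ n) f) \<xi>" .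
qed

theorem theorem3:
  fixes p q \<beta> :: real and n \<alpha> :: nat and f :: "real \<Rightarrow> real"
  assumes "p > 1" and "q > 1" and "1 / p + 1 / q = 1"
    and "n \<ge> 2" and "even n" and "\<alpha> \<ge> 1"
    and "\<beta> > (1 / real \<alpha>) * (1 / p + real n + 2)"
    and "Cn n f" and "memLp p ((deriv ^^ n) f)"
  shows "0 < tau_tilde p n \<alpha> \<beta>
      \<and> set_integrable lborel {0<..} (tau_integrand p n \<alpha> \<beta>)
      \<and> (\<forall>\<xi>>0. memLp p (Kfun \<alpha> \<beta> n \<xi> f)
             \<and> Lp_norm p (Kfun \<alpha> \<beta> n \<xi> f)
                 \<le> bound_const p q n \<alpha> \<beta> * \<xi> ^ n * omega2 p ((deriv ^^ n) f) \<xi>)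
      \<and> ((\<lambda>\<xi>. Lp_norm p (Kfun \<alpha> \<beta> n \<xi> f)) \<longlongrightarrow> 0) (at_right 0)
      \<and> ((\<forall>m\<in>{1..n div 2}. memLp p ((deriv ^^ (2 * m)) f)) \<longrightarrow>
           (\<forall>\<xi>>0. memLp p (\<lambda>x. Mop \<alpha> \<beta> \<xi> f x - f x))
           \<and> ((\<lambda>\<xi>. Lp_norm p (\<lambda>x. Mop \<alpha> \<beta> \<xi> f x - f x)) \<longlongrightarrow> 0) (at_right 0))"
proof -
  let ?g = "(deriv ^^ n) f"
  have p: "p \<ge> 1" and p0: "p > 0" and n: "n \<ge> 1"
    using assms(1,4) by auto
  note K = Lp_norm_Kfun_le[OF assms(6,7) _ assms(8,4,5,1,2,3,9)]
  have K_tendsto: "((\<lambda>\<xi>. Lp_norm p (Kfun \<alpha> \<beta> n \<xi> f)) \<longlongrightarrow> 0) (at_right 0)"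
  proof (rule tendsto_sandwich[where f = "\<lambda>_. 0"])
    show "\<forall>\<^sub>F \<xi> in at_right 0. Lp_norm p (Kfun \<alpha> \<beta> n \<xi> f) \<le> bound_const p q n \<alpha> \<beta> * \<xi> ^ n * (4 * Lp_norm p ?g)"
      using eventually_at_right_less[of "0::real"]
    proof eventually_elim
      case (elim \<xi>)
      have "omega2 p ?g \<xi> \<le> 4 * Lp_norm p ?g"
        using elim by (intro omega2_le p assms(9)) auto
      then have "bound_const p q n \<alpha> \<beta> * \<xi> ^ n * omega2 p ?g \<xi> \<le> bound_const p q n \<alpha> \<beta> * \<xi> ^ n * (4 * Lp_norm p ?g)"
        using K(3)[OF elim] elim by (intro mult_left_mono) auto
      then show ?case
        using K(2)[OF elim] by linarith
    qed
    have "((\<lambda>\<xi>. bound_const p q n \<alpha> \<beta> * \<xi> ^ n * (4 * Lp_norm p ?g)) \<longlongrightarrow> bound_const p q n \<alpha> \<beta> * 0 ^ n * (4 * Lp_norm p ?g)) (at_right 0)"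
      by (intro tendsto_intros)
    then show "((\<lambda>\<xi>. bound_const p q n \<alpha> \<beta> * \<xi> ^ n * (4 * Lp_norm p ?g)) \<longlongrightarrow> 0) (at_right 0)"
      using n by (simp add: power_0_left)
  qed auto
  have M: "(\<forall>\<xi>>0. memLp p (\<lambda>x. Mop \<alpha> \<beta> \<xi> f x - f x))
      \<and> ((\<lambda>\<xi>. Lp_norm p (\<lambda>x. Mop \<alpha> \<beta> \<xi> f x - f x)) \<longlongrightarrow> 0) (at_right 0)"
    if deriv: "\<forall>m\<in>{1..n div 2}. memLp p ((deriv ^^ (2 * m)) f)"
  proof -
    define c where "c \<rho> = (Gamma ((2 * real \<rho> + 1) / (2 * real \<alpha>)) * Gamma (\<beta> - (2 * real \<rho> + 1) / (2 * real \<alpha>))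
      / (Gamma (1 / (2 * real \<alpha>)) * Gamma (\<beta> - 1 / (2 * real \<alpha>)))) / fact (2 * \<rho>)" for \<rho>
    define S where "S \<xi> x = (\<Sum>\<rho>\<in>{1..n div 2}. (c \<rho> * \<xi> ^ (2 * \<rho>)) * (deriv ^^ (2 * \<rho>)) f x)" for \<xi> x
    \<comment> \<open>Every term of S carries a factor \<xi>^(2\<rho>) with \<rho> at least 1 and a
      fixed function in L_p, so S tends to 0 in norm together with K.\<close>
    have eq: "(\<lambda>x. Mop \<alpha> \<beta> \<xi> f x - f x) = (\<lambda>x. Kfun \<alpha> \<beta> n \<xi> f x + S \<xi> x)" for \<xi>
      by (rule ext) (simp add: Kfun_def S_def c_def mult_ac)
    have summand: "memLp p (\<lambda>x. (c \<rho> * \<xi> ^ (2 * \<rho>)) * (deriv ^^ (2 * \<rho>)) f x)"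
      "Lp_norm p (\<lambda>x. (c \<rho> * \<xi> ^ (2 * \<rho>)) * (deriv ^^ (2 * \<rho>)) f x) = \<bar>c \<rho>\<bar> * \<xi> ^ (2 * \<rho>) * Lp_norm p ((deriv ^^ (2 * \<rho>)) f)"
      if "\<rho> \<in> {1..n div 2}" for \<rho> \<xi>
      using memLp_cmult[OF _ p0, of "(deriv ^^ (2 * \<rho>)) f" "c \<rho> * \<xi> ^ (2 * \<rho>)"] deriv that
      by (auto simp: abs_mult)
    have S: "memLp p (S \<xi>)"
      "Lp_norm p (S \<xi>) \<le> (\<Sum>\<rho>\<in>{1..n div 2}. \<bar>c \<rho>\<bar> * \<xi> ^ (2 * \<rho>) * Lp_norm p ((deriv ^^ (2 * \<rho>)) f))" for \<xi>
    proof -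
      show "memLp p (S \<xi>)"
        unfolding S_def[abs_def] by (intro memLp_sum_mem p summand) auto
      have "Lp_norm p (S \<xi>) \<le> (\<Sum>\<rho>\<in>{1..n div 2}. Lp_norm p (\<lambda>x. (c \<rho> * \<xi> ^ (2 * \<rho>)) * (deriv ^^ (2 * \<rho>)) f x))"
        unfolding S_def[abs_def] by (intro Lp_norm_sum_le p summand) auto
      also have "\<dots> = (\<Sum>\<rho>\<in>{1..n div 2}. \<bar>c \<rho>\<bar> * \<xi> ^ (2 * \<rho>) * Lp_norm p ((deriv ^^ (2 * \<rho>)) f))"
        by (intro sum.cong summand refl)
      finally show "Lp_norm p (S \<xi>) \<le> (\<Sum>\<rho>\<in>{1..n div 2}. \<bar>c \<rho>\<bar> * \<xi> ^ (2 * \<rho>) * Lp_norm p ((deriv ^^ (2 * \<rho>)) f))" .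
    qed
    have mem: "memLp p (\<lambda>x. Mop \<alpha> \<beta> \<xi> f x - f x)"
      "Lp_norm p (\<lambda>x. Mop \<alpha> \<beta> \<xi> f x - f x) \<le> Lp_norm p (Kfun \<alpha> \<beta> n \<xi> f)
        + (\<Sum>\<rho>\<in>{1..n div 2}. \<bar>c \<rho>\<bar> * \<xi> ^ (2 * \<rho>) * Lp_norm p ((deriv ^^ (2 * \<rho>)) f))" if "\<xi> > 0" for \<xi>
      using memLp_add[OF p K(1)[OF that] S(1)[of \<xi>]] S(2)[of \<xi>] unfolding eq by auto
    have "((\<lambda>\<xi>. Lp_norm p (\<lambda>x. Mop \<alpha> \<beta> \<xi> f x - f x)) \<longlongrightarrow> 0) (at_right 0)"
    proof (rule tendsto_sandwich[where f = "\<lambda>_. 0"])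
      show "\<forall>\<^sub>F \<xi> in at_right 0. Lp_norm p (\<lambda>x. Mop \<alpha> \<beta> \<xi> f x - f x) \<le> Lp_norm p (Kfun \<alpha> \<beta> n \<xi> f)
        + (\<Sum>\<rho>\<in>{1..n div 2}. \<bar>c \<rho>\<bar> * \<xi> ^ (2 * \<rho>) * Lp_norm p ((deriv ^^ (2 * \<rho>)) f))"
        using eventually_at_right_less[of "0::real"] by eventually_elim (rule mem(2))
      have "((\<lambda>\<xi>. Lp_norm p (Kfun \<alpha> \<beta> n \<xi> f)
        + (\<Sum>\<rho>\<in>{1..n div 2}. \<bar>c \<rho>\<bar> * \<xi> ^ (2 * \<rho>) * Lp_norm p ((deriv ^^ (2 * \<rho>)) f))) \<longlongrightarrow>
        0 + (\<Sum>\<rho>\<in>{1..n div 2}. \<bar>c \<rho>\<bar> * 0 ^ (2 * \<rho>) * Lp_norm p ((deriv ^^ (2 * \<rho>)) f))) (at_right 0)"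
        by (intro tendsto_intros K_tendsto)
      also have "0 + (\<Sum>\<rho>\<in>{1..n div 2}. \<bar>c \<rho>\<bar> * 0 ^ (2 * \<rho>) * Lp_norm p ((deriv ^^ (2 * \<rho>)) f)) = 0"
        by (auto intro!: sum.neutral)
      finally show "((\<lambda>\<xi>. Lp_norm p (Kfun \<alpha> \<beta> n \<xi> f)
        + (\<Sum>\<rho>\<in>{1..n div 2}. \<bar>c \<rho>\<bar> * \<xi> ^ (2 * \<rho>) * Lp_norm p ((deriv ^^ (2 * \<rho>)) f))) \<longlongrightarrow> 0) (at_right 0)" .
    qed auto
    then show ?thesis
      using mem(1) by blast
  qed
  show ?thesis
    using tau_tilde_pos[OF p n assms(6,7)] set_integrable_tau[OF p n assms(6,7)] K(1,2) K_tendsto M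
    by blast
qed

end
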